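(* The group $\mathcal{F}$ contains a non-Abelian free subgroup.
   Context: The group $\mathcal{F}$. Consider (finite or infinite) rooted full binary trees: every vertex is a leaf or has exactly two children, the left edge being labeled $0$ and the right edge $1$. A branch is a maximal simple path starting at the root, identified with its (finite or infinite) binary label; branches are ordered left to right (lexicographically). For a finite binary word $p$, $[p]$ denotes the interval $[.p,.p1^{\mathbb{N}}]$ (binary expansions); an infinite branch $\omega$ corresponds to the single point $.\omega$. $\mathcal{F}$ consists of the triples $(T_+,T_-,\phi)$, where $T_+,T_-$ are such binary trees with the same finite number of infinite branches, and $\phi$ is an order-preserving (left to right) bijection from the branches of $T_+$ to the branches of $T_-$ taking infinite branches to infinite branches; triples are taken modulo inserting/reducing pairs of common carets (a caret being a vertex with two children, common if it occurs at corresponding branches of both trees). Each triple defines a homeomorphism of $[0,1]$ mapping $[p]$ linearly onto $[\phi(p)]$ for every finite branch $p$ of $T_+$ and $.\omega$ to $.\phi(\omega)$ for every infinite branch $\omega$. This identifies $\mathcal{F}$ with a subgroup of $\mathrm{Homeo}([0,1])$, and group operations are those of $\mathrm{Homeo}([0,1])$. *)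

theory Defs
  imports "HOL-Analysis.Analysis" "HOL-Library.Sublist" "HOL-Algebra.Bij"
begin

section \<open>Free groups\<close>

text \<open>A letter \<open>(x, True)\<close> stands for the generator \<open>x\<close> and \<open>(x, False)\<close> for its inverse.\<close>

definition cancels :: "'a \<times> bool \<Rightarrow> 'a \<times> bool \<Rightarrow> bool" where
  "cancels a b \<longleftrightarrow> fst a = fst b \<and> snd a \<noteq> snd b"

definition reduced_word :: "('a \<times> bool) list \<Rightarrow> bool" where
  "reduced_word w \<longleftrightarrow> successively (\<lambda>a b. \<not> cancels a b) w"

fun cons_reduce :: "'a \<times> bool \<Rightarrow> ('a \<times> bool) list \<Rightarrow> ('a \<times> bool) list" where
  "cons_reduce a [] = [a]"
| "cons_reduce a (b # w) = (if cancels a b then w else a # b # w)"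

definition free_group :: "'a set \<Rightarrow> ('a \<times> bool) list monoid" where
  "free_group X =
    \<lparr>carrier = {w \<in> lists (X \<times> UNIV). reduced_word w},
     mult = (\<lambda>u v. foldr cons_reduce u v),
     one = []\<rparr>"

text \<open>The generators may be taken from the type of elements of \<open>G\<close> without loss of
  generality: a basis of a free group is in bijection with a subset of its carrier.\<close>

definition is_free_group :: "('a, 'b) monoid_scheme \<Rightarrow> bool" where
  "is_free_group G \<longleftrightarrow> group G \<and> (\<exists>X :: 'a set. free_group X \<cong> G)"

lemma reduced_word_simps [simp]:
  "reduced_word []"
  "reduced_word [a]"
  "reduced_word (a # b # w) \<longleftrightarrow> \<not> cancels a b \<and> reduced_word (b # w)"
  by (simp_all add: reduced_word_def)

lemma reduced_word_ConsD: "reduced_word (a # w) \<Longrightarrow> reduced_word w"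
  by (cases w) auto

lemma reduced_cons_reduce: "reduced_word w \<Longrightarrow> reduced_word (cons_reduce a w)"
  by (cases w) (auto dest: reduced_word_ConsD)

lemma reduced_foldr: "reduced_word v \<Longrightarrow> reduced_word (foldr cons_reduce u v)"
  by (induction u) (auto intro: reduced_cons_reduce)

lemma cons_reduce_cancel:
  assumes "reduced_word w" "cancels a b"
  shows "cons_reduce a (cons_reduce b w) = w"
proof (cases w)
  case Nil
  then show ?thesis using assms by simp
next
  case (Cons c v)
  show ?thesis
  proof (cases "cancels b c")
    case True
    then have "c = a" using assms(2) by (auto simp: cancels_def prod_eq_iff)
    then show ?thesis using assms Cons True by (cases v) auto
  next
    case False
    then show ?thesis using Cons assms by auto
  qed
qed

lemma foldr_cons_reduce_assoc:
  assumes "reduced_word w"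
  shows "foldr cons_reduce (foldr cons_reduce u v) w
       = foldr cons_reduce u (foldr cons_reduce v w)"
proof (induction u)
  case (Cons a u)
  have "foldr cons_reduce (cons_reduce a s) w = cons_reduce a (foldr cons_reduce s w)" for s
  proof (cases s)
    case (Cons b t)
    then show ?thesis
      using cons_reduce_cancel[OF reduced_foldr[OF assms, of t], of a b] by auto
  qed simp
  then show ?case using Cons by simp
qed simp

lemma foldr_cons_reduce_lists:
  assumes "u \<in> lists A" "v \<in> lists A"
  shows "foldr cons_reduce u v \<in> lists A"
proof -
  have "set (cons_reduce a w) \<subseteq> insert a (set w)" for a :: "'a \<times> bool" and w
    by (cases w) auto
  then have "set (foldr cons_reduce u v) \<subseteq> set u \<union> set v"
    by (induction u) fastforce+
  then show ?thesis using assms by (auto simp: in_lists_conv_set)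
qed

lemma foldr_cons_reduce_Nil: "reduced_word w \<Longrightarrow> foldr cons_reduce w [] = w"
proof (induction w)
  case (Cons a w)
  then show ?case by (cases w) auto
qed simp

lemma free_group_left_inverse:
  assumes "u \<in> lists (X \<times> UNIV)" "reduced_word u"
  shows "\<exists>v. v \<in> lists (X \<times> UNIV) \<and> reduced_word v \<and> foldr cons_reduce v u = []"
proof -
  define v where "v = foldr cons_reduce (rev (map (\<lambda>a. (fst a, \<not> snd a)) u)) []"
  have "foldr cons_reduce (rev (map (\<lambda>a. (fst a, \<not> snd a)) u)) u = []"
    by (induction u) (auto simp: cancels_def)
  then have "foldr cons_reduce v u = []"
    unfolding v_def by (subst foldr_cons_reduce_assoc[OF assms(2)]) simp
  moreover have "v \<in> lists (X \<times> UNIV)"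
    unfolding v_def using assms(1)
    by (intro foldr_cons_reduce_lists) (auto simp: in_lists_conv_set)
  ultimately show ?thesis
    unfolding v_def by (meson reduced_foldr reduced_word_simps(1))
qed

lemma group_free_group: "group (free_group X)"
proof (rule groupI)
  fix u v assume "u \<in> carrier (free_group X)" "v \<in> carrier (free_group X)"
  then show "u \<otimes>\<^bsub>free_group X\<^esub> v \<in> carrier (free_group X)"
    using foldr_cons_reduce_lists[of u "X \<times> UNIV" v]
    by (simp add: free_group_def reduced_foldr del: in_lists_conv_set)
next
  fix u assume "u \<in> carrier (free_group X)"
  then show "\<exists>v \<in> carrier (free_group X). v \<otimes>\<^bsub>free_group X\<^esub> u = \<one>\<^bsub>free_group X\<^esub>"
    using free_group_left_inverse[of u X] by (auto simp: free_group_def)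
qed (auto simp: free_group_def foldr_cons_reduce_assoc)

section \<open>Homeomorphisms of the unit interval\<close>

definition homeo_unit :: "(real \<Rightarrow> real) set" where
  "homeo_unit = {f \<in> extensional {0..1}. \<exists>g. homeomorphism {0..1} {0..1} f g}"

definition Homeo_unit :: "(real \<Rightarrow> real) monoid" where
  "Homeo_unit = (BijGroup {0..1})\<lparr>carrier := homeo_unit\<rparr>"

lemma homeo_unit_subset_Bij: "homeo_unit \<subseteq> Bij {0..1}"
  by (auto simp: homeo_unit_def Bij_def homeomorphism_def intro!: bij_betw_byWitness)

lemma group_Homeo_unit: "group Homeo_unit"
  unfolding Homeo_unit_def
proof (rule group.subgroup_imp_group[OF group_BijGroup], rule group.subgroupI[OF group_BijGroup])
  show "homeo_unit \<subseteq> carrier (BijGroup {0..1})"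
    using homeo_unit_subset_Bij by (simp add: BijGroup_def)
  have "restrict id {0..1} \<in> homeo_unit"
    using homeomorphism_cong[OF homeomorphism_ident[of "{0..1::real}"],
        of "{0..1}" "{0..1}" "restrict id {0..1}" id]
    by (auto simp: homeo_unit_def)
  then show "homeo_unit \<noteq> {}" by blast
next
  fix f assume f: "f \<in> homeo_unit"
  then obtain g where g: "homeomorphism {0..1} {0..1} f g"
    by (auto simp: homeo_unit_def)
  define k where "k = restrict g {0..1}"
  have "homeomorphism {0..1} {0..1} k f"
    unfolding k_def using homeomorphism_cong[OF homeomorphism_symD[OF g]] by auto
  then have k: "k \<in> homeo_unit" by (auto simp: homeo_unit_def k_def)
  have "compose {0..1} k f = (\<lambda>x\<in>{0..1}. x)"
    using g by (auto simp: compose_def k_def homeomorphism_def fun_eq_iff)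
  then have "k \<otimes>\<^bsub>BijGroup {0..1}\<^esub> f = \<one>\<^bsub>BijGroup {0..1}\<^esub>"
    using f k homeo_unit_subset_Bij by (auto simp: BijGroup_def)
  then have "inv\<^bsub>BijGroup {0..1}\<^esub> f = k"
    using f k homeo_unit_subset_Bij
    by (intro group.inv_equality[OF group_BijGroup]) (auto simp: BijGroup_def)
  then show "inv\<^bsub>BijGroup {0..1}\<^esub> f \<in> homeo_unit" using k by simp
next
  fix f f' assume f: "f \<in> homeo_unit" and f': "f' \<in> homeo_unit"
  then obtain g g' where "homeomorphism {0..1} {0..1} f g" "homeomorphism {0..1} {0..1} f' g'"
    by (auto simp: homeo_unit_def)
  then have "homeomorphism {0..1} {0..1} (f \<circ> f') (g' \<circ> g)"
    by (blast intro: homeomorphism_compose)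
  then have "homeomorphism {0..1} {0..1} (compose {0..1} f f') (g' \<circ> g)"
    by (rule homeomorphism_cong) (auto simp: compose_def)
  then have "compose {0..1} f f' \<in> homeo_unit"
    by (auto simp: homeo_unit_def)
  then show "f \<otimes>\<^bsub>BijGroup {0..1}\<^esub> f' \<in> homeo_unit"
    using f f' homeo_unit_subset_Bij by (auto simp: BijGroup_def)
qed

section \<open>Rooted full binary trees and their branches\<close>

text \<open>Vertices are finite binary words (the addresses from the root); \<open>False\<close> is the label 0
  of a left edge and \<open>True\<close> the label 1 of a right edge.\<close>

definition full_binary_tree :: "bool list set \<Rightarrow> bool" where
  "full_binary_tree T \<longleftrightarrow>
     [] \<in> T \<and> (\<forall>p b. p @ [b] \<in> T \<longrightarrow> p \<in> T) \<and> (\<forall>p. p @ [False] \<in> T \<longleftrightarrow> p @ [True] \<in> T)"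

datatype branch = FinBranch "bool list" | InfBranch "nat \<Rightarrow> bool"

fun branch_vertices :: "branch \<Rightarrow> bool list set" where
  "branch_vertices (FinBranch p) = {q. prefix q p}"
| "branch_vertices (InfBranch \<omega>) = {map \<omega> [0..<n] | n. True}"

definition fin_branches :: "bool list set \<Rightarrow> branch set" where
  "fin_branches T = {FinBranch p | p. p \<in> T \<and> (\<forall>b. p @ [b] \<notin> T)}"

definition inf_branches :: "bool list set \<Rightarrow> branch set" where
  "inf_branches T = {InfBranch \<omega> | \<omega>. branch_vertices (InfBranch \<omega>) \<subseteq> T}"

definition branches :: "bool list set \<Rightarrow> branch set" where
  "branches T = fin_branches T \<union> inf_branches T"

text \<open>Two distinct branches of one tree separate at a vertex \<open>p\<close>, so this is the (strict)
  lexicographic order on the branches of any given tree.\<close>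

definition left_of :: "branch \<Rightarrow> branch \<Rightarrow> bool" where
  "left_of b c \<longleftrightarrow> (\<exists>p. p @ [False] \<in> branch_vertices b \<and> p @ [True] \<in> branch_vertices c)"

section \<open>The group \<open>\<F>\<close>\<close>

definition tree_triple :: "bool list set \<Rightarrow> bool list set \<Rightarrow> (branch \<Rightarrow> branch) \<Rightarrow> bool" where
  "tree_triple T S \<phi> \<longleftrightarrow>
     full_binary_tree T \<and> full_binary_tree S \<and>
     finite (inf_branches T) \<and> finite (inf_branches S) \<and>
     card (inf_branches T) = card (inf_branches S) \<and>
     bij_betw \<phi> (branches T) (branches S) \<and>
     \<phi> ` inf_branches T \<subseteq> inf_branches S \<and>
     (\<forall>b \<in> branches T. \<forall>c \<in> branches T. left_of b c \<longrightarrow> left_of (\<phi> b) (\<phi> c))"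

definition bin_value :: "(nat \<Rightarrow> bool) \<Rightarrow> real" where
  "bin_value \<omega> = (\<Sum>n. of_bool (\<omega> n) / 2 ^ Suc n)"

text \<open>\<open>append_const p d\<close> is the infinite word \<open>p d d d \<dots>\<close>, so that the interval \<open>[p]\<close> is
  \<open>{lower p .. upper p}\<close>.\<close>

definition append_const :: "bool list \<Rightarrow> bool \<Rightarrow> nat \<Rightarrow> bool" where
  "append_const p d = (\<lambda>n. if n < length p then p ! n else d)"

definition lower :: "bool list \<Rightarrow> real" where
  "lower p = bin_value (append_const p False)"

definition upper :: "bool list \<Rightarrow> real" where
  "upper p = bin_value (append_const p True)"

text \<open>\<open>h\<close> maps \<open>[p]\<close> linearly and increasingly onto \<open>[\<phi> p]\<close> for each finite branch \<open>p\<close>, and the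
  point of each infinite branch \<open>\<omega>\<close> to that of \<open>\<phi> \<omega>\<close>.\<close>

definition induces ::
  "bool list set \<Rightarrow> (branch \<Rightarrow> branch) \<Rightarrow> (real \<Rightarrow> real) \<Rightarrow> bool" where
  "induces T \<phi> h \<longleftrightarrow>
     (\<forall>p q. FinBranch p \<in> branches T \<and> \<phi> (FinBranch p) = FinBranch q \<longrightarrow>
        (\<forall>t \<in> {0..1}. h ((1 - t) * lower p + t * upper p) = (1 - t) * lower q + t * upper q)) \<and>
     (\<forall>\<omega> \<eta>. InfBranch \<omega> \<in> branches T \<and> \<phi> (InfBranch \<omega>) = InfBranch \<eta> \<longrightarrow>
        h (bin_value \<omega>) = bin_value \<eta>)"

text \<open>Triples that differ by common carets induce the same homeomorphism, so \<open>\<F>\<close> is the set of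
  homeomorphisms induced by triples.\<close>

definition F_group :: "(real \<Rightarrow> real) monoid" where
  "F_group = Homeo_unit
     \<lparr>carrier := {h \<in> carrier Homeo_unit. \<exists>T S \<phi>. tree_triple T S \<phi> \<and> induces T \<phi> h}\<rparr>"

end

theory Submission
  imports Defs "HOL-Algebra.Coset"
begin

text \<open>
  One infinite branch already makes \<open>\<F>\<close> large enough. Cut \<open>[0,1)\<close> into the intervals
  \<open>[1\<^sup>n0]\<close> and stretch each of them affinely onto \<open>[n, n+1]\<close>; then \<open>[0,1)\<close> becomes the half-line
  \<open>[0,\<infinity>)\<close>. Call an increasing bijection \<open>h\<close> of the half-line uniformly dyadic if, for some \<open>k\<close>,
  it maps every dyadic interval of length \<open>2\<^sup>-\<^sup>k\<close> inside a cell \<open>[n, n+1]\<close> affinely onto a dyadic interval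
  inside a cell. If \<open>h\<close> and its inverse are uniformly dyadic, then \<open>h\<close>, carried back to \<open>[0,1]\<close>, lies in
  \<open>\<F>\<close> (\<open>transport_in_F_group\<close>): the maximal dyadic intervals in \<open>[0,1)\<close> that it maps affinely
  onto dyadic intervals are the finite branches of a tree whose only infinite branch is \<open>1\<^sup>\<nat>\<close>, and
  their images are the finite branches of a second such tree. A composition of uniformly dyadic
  maps is uniformly dyadic, because the levels add up, so a whole group of homeomorphisms can be
  shown to lie in \<open>\<F>\<close> by looking at its generators only.

  It remains to find two such maps that generate a free group. In \<open>[0,5]\<close> consider the bump with
  slope \<open>4\<close> on \<open>[0,1]\<close> and slope \<open>1/4\<close> on \<open>[1,5]\<close>: it sends everything outside \<open>[0,1)\<close> into \<open>[4,5)\<close>,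
  and its inverse sends everything outside \<open>[4,5)\<close> into \<open>[0,1)\<close>. Repeat it with period \<open>5\<close> along the
  half-line, and let the second map be its translate by \<open>2\<close>. Modulo \<open>5\<close> the two maps
  and their inverses now attract to the four distinct unit cells \<open>4\<close>, \<open>0\<close>, \<open>1\<close>, \<open>2\<close>, and cell \<open>3\<close>
  is left over as a starting position. The translate behaves periodically only to the right of \<open>2\<close>, but one
  letter moves a point by at most \<open>5\<close>, so a word of length \<open>l\<close> applied to \<open>5l + 3\<close> never leaves the region
  where the ping-pong argument works (\<open>play_ping_pong\<close>). Hence no nonempty reduced word acts
  trivially, which is the criterion \<open>free_subgroup_if_no_relations\<close> for freeness. That criterion is
  applied in the group of all homeomorphisms of \<open>[0,1]\<close>, and the resulting subgroup is contained in \<open>\<F>\<close>.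
\<close>

section \<open>Dyadic intervals\<close>

lemma bin_value_split:
  "bin_value \<omega> = (of_bool (\<omega> 0) + bin_value (\<lambda>n. \<omega> (Suc n))) / 2"
proof -
  have summable: "summable (\<lambda>n. of_bool (\<omega> n) / 2 ^ Suc n :: real)" for \<omega> :: "nat \<Rightarrow> bool"
  proof (rule summable_comparison_test')
    show "summable (\<lambda>n. (1/2) ^ n :: real)" by (rule summable_geometric) simp
    show "norm (of_bool (\<omega> n) / 2 ^ Suc n :: real) \<le> (1/2) ^ n" if "n \<ge> 0" for n
      by (simp add: power_divide field_simps)
  qed
  have "bin_value \<omega> = of_bool (\<omega> 0) / 2 + (\<Sum>n. of_bool (\<omega> (Suc n)) / 2 ^ Suc n / 2)"
    unfolding bin_value_def using suminf_split_head[OF summable[of \<omega>]] by (simp add: mult.commute)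
  also have "(\<Sum>n. of_bool (\<omega> (Suc n)) / 2 ^ Suc n / 2) = bin_value (\<lambda>n. \<omega> (Suc n)) / 2"
    unfolding bin_value_def by (rule suminf_divide[OF summable])
  finally show ?thesis by (simp add: add_divide_distrib)
qed

lemma lower_simps [simp]:
  "lower [] = 0"
  "lower (b # p) = (of_bool b + lower p) / 2"
proof -
  show "lower [] = 0"
    by (simp add: lower_def append_const_def bin_value_def)
  show "lower (b # p) = (of_bool b + lower p) / 2"
    unfolding lower_def by (subst bin_value_split) (simp add: append_const_def)
qed

lemma upper_eq: "upper p = lower p + 1 / 2 ^ length p"
proof (induction p)
  case Nil
  have "(\<lambda>n. 1 / 2 ^ Suc n :: real) sums 1"
    using power_half_series by (simp add: power_divide)
  then show ?case
    by (simp add: upper_def append_const_def bin_value_def sums_iff)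
next
  case (Cons b p)
  have "upper (b # p) = (of_bool b + upper p) / 2"
    unfolding upper_def by (subst bin_value_split) (simp add: append_const_def)
  then show ?case using Cons by (simp add: field_simps)
qed

lemma interpolate_eq: "(1 - t) * lower p + t * upper p = lower p + t / 2 ^ length p"
  by (simp add: upper_eq algebra_simps)

lemma lower_append: "lower (p @ q) = lower p + lower q / 2 ^ length p"
  by (induction p) (auto simp: field_simps)

lemma lower_nonneg: "0 \<le> lower p"
  by (induction p) auto

lemma lower_add_le_1: "lower p + 1 / 2 ^ length p \<le> 1"
proof (induction p)
  case (Cons b p)
  have "lower (b # p) + 1 / 2 ^ length (b # p) = (of_bool b + (lower p + 1 / 2 ^ length p)) / 2"
    by (simp add: add_divide_distrib)
  also have "\<dots> \<le> (1 + 1) / 2"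
    using Cons by (intro divide_right_mono add_mono) auto
  finally show ?case by simp
qed simp

lemma lower_less_1: "lower p < 1"
  using lower_add_le_1[of p] by (smt (verit) divide_pos_pos zero_less_power)

lemma interval_point:
  assumes "t \<in> {0..1}"
  shows "lower p + t / 2 ^ length p \<in> {0..1}"
proof -
  have "t / 2 ^ length p \<le> 1 / 2 ^ length p" "0 \<le> t / 2 ^ length p"
    using assms by (auto simp: field_simps)
  then show ?thesis using lower_nonneg[of p] lower_add_le_1[of p] by auto
qed

text \<open>
  Endpoints and length of \<open>[p]\<close> determine \<open>p\<close>: the first digit can be read off from the
  position relative to \<open>1/2\<close>, since \<open>lower\<close> is always below \<open>1\<close>.
\<close>

lemma dyadic_interval_unique:
  assumes "lower p = lower q" "length p = length q"
  shows "p = q"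
  using assms(2,1)
proof (induction p q rule: list_induct2)
  case (Cons b p c q)
  then have "of_bool b + lower p = of_bool c + lower q" by simp
  then have "b = c"
    using lower_nonneg[of p] lower_nonneg[of q] lower_less_1[of p] lower_less_1[of q]
    by (cases b; cases c) auto
  then show ?case using Cons by simp
qed simp

text \<open>
  The order on finite branches is the order of their intervals on the line. This is what turns
  monotonicity of a homeomorphism into order preservation of the map of branches.
\<close>

lemma left_of_interval_le:
  assumes "left_of (FinBranch p) (FinBranch q)"
  shows "lower p + 1 / 2 ^ length p \<le> lower q"
proof -
  obtain r p' q' where p: "p = r @ [False] @ p'" and q: "q = r @ [True] @ q'"
    using assms by (auto simp: left_of_def prefix_def)
  have "lower p + 1 / 2 ^ length p = lower r + (lower p' + 1 / 2 ^ length p') / 2 / 2 ^ length r"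
    by (simp add: p lower_append field_simps power_add)
  also have "\<dots> \<le> lower r + (1 + lower q') / 2 / 2 ^ length r"
    using lower_add_le_1[of p'] lower_nonneg[of q'] by (intro add_left_mono divide_right_mono) auto
  also have "\<dots> = lower q" by (simp add: q lower_append)
  finally show ?thesis .
qed

section \<open>A criterion for freeness\<close>

definition letter_value :: "('a, 'b) monoid_scheme \<Rightarrow> 'a \<times> bool \<Rightarrow> 'a" where
  "letter_value G a = (if snd a then fst a else inv\<^bsub>G\<^esub> fst a)"

definition word_value :: "('a, 'b) monoid_scheme \<Rightarrow> ('a \<times> bool) list \<Rightarrow> 'a" where
  "word_value G w = foldr (\<lambda>a g. letter_value G a \<otimes>\<^bsub>G\<^esub> g) w \<one>\<^bsub>G\<^esub>"

lemma word_value_simps [simp]: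
  "word_value G [] = \<one>\<^bsub>G\<^esub>"
  "word_value G (a # w) = letter_value G a \<otimes>\<^bsub>G\<^esub> word_value G w"
  by (simp_all add: word_value_def)

context group
begin

lemma letter_value_closed: "a \<in> carrier G \<times> UNIV \<Longrightarrow> letter_value G a \<in> carrier G"
  by (auto simp: letter_value_def)

lemma word_value_closed: "w \<in> lists (carrier G \<times> UNIV) \<Longrightarrow> word_value G w \<in> carrier G"
  by (induction w) (auto intro: letter_value_closed simp del: in_lists_conv_set)

lemma letter_value_cancels:
  assumes "a \<in> carrier G \<times> UNIV" "cancels a b"
  shows "letter_value G a \<otimes> letter_value G b = \<one>"
  using assms by (auto simp: letter_value_def cancels_def)

text \<open>
  Cancelling a pair of letters corresponds to cancelling an element with its inverse, so evaluation
  of words is compatible with the multiplication of the free group.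
\<close>

lemma word_value_cons_reduce:
  assumes "a \<in> carrier G \<times> UNIV" "w \<in> lists (carrier G \<times> UNIV)"
  shows "word_value G (cons_reduce a w) = letter_value G a \<otimes> word_value G w"
proof (cases w)
  case (Cons b v)
  show ?thesis
  proof (cases "cancels a b")
    case True
    have b: "b \<in> carrier G \<times> UNIV" and v: "v \<in> lists (carrier G \<times> UNIV)"
      using assms(2) Cons by auto
    have "letter_value G a \<otimes> word_value G w
        = (letter_value G a \<otimes> letter_value G b) \<otimes> word_value G v"
      using Cons letter_value_closed[OF assms(1)] letter_value_closed[OF b] word_value_closed[OF v]
      by (simp add: m_assoc)
    then show ?thesis
      using True Cons letter_value_cancels[OF assms(1) True] word_value_closed[OF v] by simp
  qed (simp add: Cons)
qed simp

lemma word_value_foldr: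
  assumes "u \<in> lists (carrier G \<times> UNIV)" "v \<in> lists (carrier G \<times> UNIV)"
  shows "word_value G (foldr cons_reduce u v) = word_value G u \<otimes> word_value G v"
  using assms(1)
proof induction
  case Nil
  then show ?case using word_value_closed[OF assms(2)] by simp
next
  case (Cons a u)
  have "word_value G (foldr cons_reduce (a # u) v)
      = letter_value G a \<otimes> word_value G (foldr cons_reduce u v)"
    using word_value_cons_reduce[OF Cons.hyps(1) foldr_cons_reduce_lists[OF Cons.hyps(2) assms(2)]]
    by simp
  then show ?case
    using Cons letter_value_closed[OF Cons.hyps(1)] word_value_closed[OF Cons.hyps(2)]
      word_value_closed[OF assms(2)]
    by (simp add: m_assoc)
qed

text \<open>
  Evaluation is a homomorphism from the free group whose kernel is trivial by assumption; hence it is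
  an isomorphism onto its image.
\<close>

lemma free_subgroup_if_no_relations:
  assumes X: "X \<subseteq> carrier G"
    and nontrivial: "\<And>w. w \<in> lists (X \<times> UNIV) \<Longrightarrow> reduced_word w \<Longrightarrow> w \<noteq> [] \<Longrightarrow>
                       word_value G w \<noteq> \<one>"
  defines "H \<equiv> word_value G ` carrier (free_group X)"
  shows "subgroup H G" "is_free_group (G\<lparr>carrier := H\<rparr>)"
proof -
  have lists: "w \<in> lists (carrier G \<times> UNIV)" if "w \<in> carrier (free_group X)" for w
    using that X by (auto simp: free_group_def)
  have hom: "word_value G \<in> hom (free_group X) G"
    by (intro homI) (auto simp: lists word_value_closed word_value_foldr free_group_def
        simp del: in_lists_conv_set dest!: lists[unfolded free_group_def, simplified])
  interpret eval: group_hom "free_group X" G "word_value G"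
    by (intro group_hom.intro group_hom_axioms.intro group_free_group is_group hom)
  show H: "subgroup H G"
    unfolding H_def by (rule eval.img_is_subgroup)
  have "inj_on (word_value G) (carrier (free_group X))"
    using nontrivial by (subst eval.inj_on_one_iff) (auto simp: free_group_def)
  then have "word_value G \<in> iso (free_group X) (G\<lparr>carrier := H\<rparr>)"
    using hom by (auto simp: iso_def hom_def H_def bij_betw_def)
  then show "is_free_group (G\<lparr>carrier := H\<rparr>)"
    unfolding is_free_group_def
    using subgroup.subgroup_is_group[OF H is_group] by (blast intro: is_isoI)
qed

end

section \<open>Homeomorphisms induced by pairs of trees\<close>

text \<open>
  A monotone function with open range is continuous, as gaps in the range are the only obstruction.
  Extending by the identity outside the unit interval makes the range open.
\<close>

lemma strict_mono_surj_imp_homeo_unit: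
  assumes ext: "f \<in> extensional {0..1}" and mono: "strict_mono_on {0..1} f"
    and surj: "f ` {0..1} = {0..1}"
  shows "f \<in> homeo_unit"
proof -
  define F where "F x = (if x \<in> {0..1} then f x else x)" for x
  have F_in: "F x \<in> {0..1} \<longleftrightarrow> x \<in> {0..1}" for x
    using surj by (auto simp: F_def)
  have "F x \<le> F y" if "x \<le> y" for x y
  proof (cases "x \<in> {0..1} \<and> y \<in> {0..1}")
    case True
    then show ?thesis using strict_mono_on_leD[OF mono _ _ that] by (simp add: F_def)
  next
    case False
    then have "F x = x \<or> F y = y" by (auto simp: F_def)
    then show ?thesis using that False F_in[of x] F_in[of y] by (auto simp: F_def)
  qed
  moreover have "range F = UNIV"
  proof -
    have "y \<in> range F" for y
    proof (cases "y \<in> {0..1}")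
      case True
      then obtain x where "x \<in> {0..1}" "y = f x" using surj by blast
      then show ?thesis by (auto simp: F_def image_iff intro!: bexI[of _ x])
    next
      case False
      then show ?thesis by (auto simp: F_def image_iff intro!: bexI[of _ y])
    qed
    then show ?thesis by blast
  qed
  ultimately have "continuous_on UNIV F"
    by (intro continuous_onI_mono) auto
  then have "continuous_on {0..1} F"
    by (rule continuous_on_subset) simp
  then have "continuous_on {0..1} f"
    by (rule continuous_on_cong[THEN iffD1, rotated -1]) (auto simp: F_def)
  then have "\<exists>g. homeomorphism {0..1} {0..1} f g"
    using surj strict_mono_on_imp_inj_on[OF mono] by (intro homeomorphism_compact) auto
  then show ?thesis using ext by (simp add: homeo_unit_def)
qed

text \<open>
  The tree is cut off as soon as a word enters \<open>D\<close>. When \<open>D\<close> consists of the intervals on which a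
  map is affine, this is the reduced tree of the map: its leaves are the largest such intervals.
\<close>

definition tree_with_leaves :: "bool list set \<Rightarrow> bool list set" where
  "tree_with_leaves D = {p. \<forall>q. strict_prefix q p \<longrightarrow> q \<notin> D}"

definition minimal_words :: "bool list set \<Rightarrow> bool list set" where
  "minimal_words D = {p \<in> D. \<forall>q. strict_prefix q p \<longrightarrow> q \<notin> D}"

lemma snoc_in_tree_with_leaves:
  "p @ [b] \<in> tree_with_leaves D \<longleftrightarrow> (\<forall>q. prefix q p \<longrightarrow> q \<notin> D)"
proof -
  have "strict_prefix q (p @ [b]) \<longleftrightarrow> prefix q p" for q
    unfolding strict_prefix_def prefix_snoc using prefix_length_le[of "p @ [b]" p] by auto
  then show ?thesis by (simp add: tree_with_leaves_def)
qed

lemma full_binary_tree_with_leaves: "full_binary_tree (tree_with_leaves D)"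
proof -
  have "[] \<in> tree_with_leaves D" by (simp add: tree_with_leaves_def strict_prefix_def)
  moreover have "p \<in> tree_with_leaves D" if "\<forall>q. prefix q p \<longrightarrow> q \<notin> D" for p
    using that by (simp add: tree_with_leaves_def strict_prefix_def)
  ultimately show ?thesis
    unfolding full_binary_tree_def snoc_in_tree_with_leaves by blast
qed

lemma fin_branches_tree_with_leaves:
  "fin_branches (tree_with_leaves D) = FinBranch ` minimal_words D"
proof -
  have "p \<in> tree_with_leaves D \<and> (\<forall>b. p @ [b] \<notin> tree_with_leaves D) \<longleftrightarrow> p \<in> minimal_words D" for p
  proof
    assume p: "p \<in> tree_with_leaves D \<and> (\<forall>b. p @ [b] \<notin> tree_with_leaves D)"
    then obtain q where "prefix q p" "q \<in> D" unfolding snoc_in_tree_with_leaves by blast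
    then show "p \<in> minimal_words D"
      using p by (cases "q = p") (simp_all add: tree_with_leaves_def minimal_words_def strict_prefix_def)
  next
    assume p: "p \<in> minimal_words D"
    then show "p \<in> tree_with_leaves D \<and> (\<forall>b. p @ [b] \<notin> tree_with_leaves D)"
      unfolding snoc_in_tree_with_leaves
      by (simp add: tree_with_leaves_def minimal_words_def) (blast intro: prefix_order.refl)
  qed
  then show ?thesis by (simp add: fin_branches_def Setcompr_eq_image)
qed

lemma inf_branches_tree_with_leaves:
  "inf_branches (tree_with_leaves D) = InfBranch ` {\<omega>. \<forall>n. map \<omega> [0..<n] \<notin> D}"
proof -
  have "(\<forall>n. map \<omega> [0..<n] \<in> tree_with_leaves D) \<longleftrightarrow> (\<forall>n. map \<omega> [0..<n] \<notin> D)" for \<omega>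
  proof
    assume tree: "\<forall>n. map \<omega> [0..<n] \<in> tree_with_leaves D"
    have "map \<omega> [0..<Suc n] = map \<omega> [0..<n] @ [\<omega> n]" for n by simp
    then show "\<forall>n. map \<omega> [0..<n] \<notin> D"
      using tree snoc_in_tree_with_leaves by (metis prefix_order.refl)
  next
    assume D: "\<forall>n. map \<omega> [0..<n] \<notin> D"
    have "q \<notin> D" if "prefix q (map \<omega> [0..<n])" for q n
    proof -
      have "length q \<le> n" using prefix_length_le[OF that] by simp
      moreover have "q = take (length q) (map \<omega> [0..<n])"
        using that by (auto simp: prefix_def append_eq_conv_conj)
      ultimately have "q = map \<omega> [0..<length q]" by (simp add: take_map take_upt)
      then show ?thesis using D by metis
    qed
    then show "\<forall>n. map \<omega> [0..<n] \<in> tree_with_leaves D"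
      by (auto simp: tree_with_leaves_def strict_prefix_def)
  qed
  moreover have "branch_vertices (InfBranch \<omega>) \<subseteq> T \<longleftrightarrow> (\<forall>n. map \<omega> [0..<n] \<in> T)" for \<omega> T
    by auto
  ultimately show ?thesis by (simp add: inf_branches_def image_Collect del: branch_vertices.simps)
qed

text \<open>
  Words without a \<open>False\<close> denote the intervals that contain the point \<open>1\<close>. Excluding them forces
  the branch \<open>1\<^sup>\<nat>\<close> into every tree, even that of the identity, so that all maps
  have trees with the same number of infinite branches.
\<close>

definition affine_on :: "(real \<Rightarrow> real) \<Rightarrow> bool list \<Rightarrow> bool list \<Rightarrow> bool" where
  "affine_on f p q \<longleftrightarrow> False \<in> set p \<and> False \<in> set q \<and>
     (\<forall>t \<in> {0..1}. f (lower p + t / 2 ^ length p) = lower q + t / 2 ^ length q)"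

definition affine_domain :: "(real \<Rightarrow> real) \<Rightarrow> bool list set" where
  "affine_domain f = {p. \<exists>q. affine_on f p q}"

definition branch_map :: "(real \<Rightarrow> real) \<Rightarrow> branch \<Rightarrow> branch" where
  "branch_map f b = (case b of
     FinBranch p \<Rightarrow> FinBranch (THE q. affine_on f p q)
   | InfBranch \<omega> \<Rightarrow> InfBranch \<omega>)"

definition locally_dyadic :: "(real \<Rightarrow> real) \<Rightarrow> bool" where
  "locally_dyadic f \<longleftrightarrow>
     (\<forall>\<omega>. (\<exists>n. \<not> \<omega> n) \<longrightarrow> (\<exists>m. map \<omega> [0..<m] \<in> affine_domain f))"

lemma affine_on_lower: "affine_on f p q \<Longrightarrow> f (lower p) = lower q"
  by (force simp: affine_on_def dest: bspec[of _ _ 0])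

lemma affine_on_upper: "affine_on f p q \<Longrightarrow> f (lower p + 1 / 2 ^ length p) = lower q + 1 / 2 ^ length q"
  by (force simp: affine_on_def dest: bspec[of _ _ 1])

lemma affine_on_unique:
  assumes "affine_on f p q" "affine_on f p q'"
  shows "q = q'"
proof (rule dyadic_interval_unique)
  show lower: "lower q = lower q'"
    using assms[THEN affine_on_lower] by simp
  have "(2::real) ^ length q = 2 ^ length q'"
    using assms[THEN affine_on_upper] lower by simp
  then show "length q = length q'" by simp
qed

text \<open>
  An affine map respects subdivision, so the set of good intervals is closed under passing to
  dyadic subintervals, and their images are subdivided in the same way.
\<close>

lemma affine_on_append:
  assumes "affine_on f p q"
  shows "affine_on f (p @ r) (q @ r)"
proof -
  have "f (lower (p @ r) + t / 2 ^ length (p @ r)) = lower (q @ r) + t / 2 ^ length (q @ r)"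
    if "t \<in> {0..1}" for t
  proof -
    have eq: "lower (u @ r) + t / 2 ^ length (u @ r)
        = lower u + (lower r + t / 2 ^ length r) / 2 ^ length u" for u
      by (simp add: lower_append add_divide_distrib power_add mult.commute)
    show ?thesis
      unfolding eq using assms interval_point[OF that] by (simp add: affine_on_def)
  qed
  then show ?thesis using assms by (auto simp: affine_on_def)
qed

lemma affine_on_inverse:
  assumes "affine_on f p q" "\<And>x. x \<in> {0..1} \<Longrightarrow> g (f x) = x"
  shows "affine_on g q p"
proof -
  have "g (lower q + t / 2 ^ length q) = lower p + t / 2 ^ length p" if t: "t \<in> {0..1}" for t
  proof -
    have "g (f (lower p + t / 2 ^ length p)) = lower p + t / 2 ^ length p"
      by (rule assms(2)[OF interval_point[OF t]])
    then show ?thesis using assms(1) t by (simp add: affine_on_def)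
  qed
  then show ?thesis using assms(1) unfolding affine_on_def by blast
qed

lemma branch_map_simps:
  "branch_map f (InfBranch \<omega>) = InfBranch \<omega>"
  "affine_on f p q \<Longrightarrow> branch_map f (FinBranch p) = FinBranch q"
proof -
  show "branch_map f (InfBranch \<omega>) = InfBranch \<omega>" by (simp add: branch_map_def)
  assume pq: "affine_on f p q"
  have "(THE q. affine_on f p q) = q"
    by (rule the_equality) (auto intro: pq affine_on_unique[OF _ pq])
  then show "branch_map f (FinBranch p) = FinBranch q" by (simp add: branch_map_def)
qed

lemma inf_branches_affine_domain:
  assumes "locally_dyadic f"
  shows "inf_branches (tree_with_leaves (affine_domain f)) = {InfBranch (\<lambda>_. True)}"
proof -
  have "(\<forall>n. map \<omega> [0..<n] \<notin> affine_domain f) \<longleftrightarrow> \<omega> = (\<lambda>_. True)" for \<omega>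
  proof
    assume "\<forall>n. map \<omega> [0..<n] \<notin> affine_domain f"
    then have "\<forall>n. \<omega> n" using assms unfolding locally_dyadic_def by blast
    then show "\<omega> = (\<lambda>_. True)" by blast
  next
    assume "\<omega> = (\<lambda>_. True)"
    then have "False \<notin> set (map \<omega> [0..<n])" for n by auto
    then show "\<forall>n. map \<omega> [0..<n] \<notin> affine_domain f"
      unfolding affine_domain_def affine_on_def by blast
  qed
  then show ?thesis by (simp add: inf_branches_tree_with_leaves)
qed

text \<open>
  If the image \<open>q\<close> of a maximal interval \<open>p\<close> were properly contained in an interval on which the inverse
  is affine, then \<open>p\<close> would be properly contained in the image of the latter. Thus the
  leaves of the tree of \<open>f\<close> correspond to the leaves of the tree of its inverse.
\<close>

lemma minimal_words_affine_image:
  assumes p: "p \<in> minimal_words (affine_domain f)" and pq: "affine_on f p q"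
    and fg: "\<And>x. x \<in> {0..1} \<Longrightarrow> f (g x) = x" and gf: "\<And>x. x \<in> {0..1} \<Longrightarrow> g (f x) = x"
  shows "q \<in> minimal_words (affine_domain g)"
proof -
  have "q' \<notin> affine_domain g" if sp: "strict_prefix q' q" for q'
  proof
    assume "q' \<in> affine_domain g"
    then obtain p' where p': "affine_on g q' p'" by (auto simp: affine_domain_def)
    obtain b r where r: "q = q' @ b # r"
      using sp by (elim strict_prefixE')
    have "affine_on g q (p' @ b # r)" using affine_on_append[OF p'] r by simp
    then have "p = p' @ b # r"
      using affine_on_unique affine_on_inverse[OF pq gf] by blast
    moreover have "p' \<in> affine_domain f"
      using affine_on_inverse[OF p' fg] by (auto simp: affine_domain_def)
    moreover have "strict_prefix p' (p' @ b # r)" by (simp add: strict_prefix_def)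
    ultimately show False
      using p unfolding minimal_words_def by blast
  qed
  then show ?thesis
    using affine_on_inverse[OF pq gf] unfolding minimal_words_def affine_domain_def by blast
qed

lemma minimal_words_left_or_right:
  assumes "p \<in> minimal_words D" "q \<in> minimal_words D" "p \<noteq> q"
  shows "left_of (FinBranch p) (FinBranch q) \<or> left_of (FinBranch q) (FinBranch p)"
proof -
  have "p \<parallel> q"
    using assms unfolding minimal_words_def parallel_def strict_prefix_def by blast
  from parallel_decomp[OF this]
  obtain r b p' c q' where r: "b \<noteq> c" "p = r @ b # p'" "q = r @ c # q'"
    by (elim exE conjE)
  have "left_of (FinBranch (u @ False # v)) (FinBranch (u @ True # w))" for u v w
    unfolding left_of_def by (intro exI[of _ u]) (simp add: prefix_def)
  then show ?thesis using r by (cases b; cases c) simp_all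
qed

lemma left_of_all_True:
  assumes "False \<in> set p"
  shows "left_of (FinBranch p) (InfBranch (\<lambda>_. True))"
proof -
  obtain r s where p: "p = r @ False # s" "False \<notin> set r"
    using split_list_first[OF assms] by blast
  from p(2) have "r = map (\<lambda>_. True) [0..<length r]" by (induction r rule: rev_induct) auto
  then have "r @ [True] = map (\<lambda>_. True) [0..<Suc (length r)]" by simp
  then have "r @ [True] \<in> branch_vertices (InfBranch (\<lambda>_. True))"
    unfolding branch_vertices.simps by blast
  moreover have "r @ [False] \<in> branch_vertices (FinBranch p)" by (simp add: p(1) prefix_def)
  ultimately show ?thesis unfolding left_of_def by blast
qed

lemma not_left_of_all_True: "\<not> left_of (InfBranch (\<lambda>_. True)) b"
proof
  assume "left_of (InfBranch (\<lambda>_. True)) b"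
  then obtain p n where "p @ [False] = map (\<lambda>_. True) [0..<n]"
    by (auto simp: left_of_def)
  then have "False \<in> set (map (\<lambda>_. True) [0..<n])" by (metis in_set_conv_decomp)
  then show False by auto
qed

definition tree_of :: "(real \<Rightarrow> real) \<Rightarrow> bool list set" where
  "tree_of f = tree_with_leaves (affine_domain f)"

lemma branches_tree_of:
  assumes "locally_dyadic f"
  shows "branches (tree_of f) =
    FinBranch ` minimal_words (affine_domain f) \<union> {InfBranch (\<lambda>_. True)}"
  by (simp add: branches_def tree_of_def fin_branches_tree_with_leaves
      inf_branches_affine_domain[OF assms])

lemma branch_of_tree_cases:
  assumes "b \<in> branches (tree_of f)" "locally_dyadic f"
  obtains (fin) p q where "b = FinBranch p" "p \<in> minimal_words (affine_domain f)" "affine_on f p q"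
    | (inf) "b = InfBranch (\<lambda>_. True)"
proof -
  consider p where "b = FinBranch p" "p \<in> minimal_words (affine_domain f)"
    | "b = InfBranch (\<lambda>_. True)"
    using assms(1) unfolding branches_tree_of[OF assms(2)] by (elim UnE imageE singletonE)
  then show ?thesis
  proof cases
    case 1
    from 1(2) obtain q where "affine_on f p q"
      unfolding minimal_words_def affine_domain_def by (elim CollectE conjE exE)
    then show ?thesis using 1 by (rule fin[rotated 2])
  next
    case 2
    then show ?thesis by (rule inf)
  qed
qed

lemma branch_map_inverse:
  assumes b: "b \<in> branches (tree_of f)" and f: "locally_dyadic f" and g: "locally_dyadic g"
    and inv: "\<And>x. x \<in> {0..1} \<Longrightarrow> f (g x) = x" "\<And>x. x \<in> {0..1} \<Longrightarrow> g (f x) = x"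
  shows "branch_map f b \<in> branches (tree_of g) \<and> branch_map g (branch_map f b) = b"
  using b f
proof (cases rule: branch_of_tree_cases)
  case (fin p q)
  then show ?thesis
    using minimal_words_affine_image[OF fin(2,3) inv] affine_on_inverse[OF fin(3) inv(2)]
    by (simp add: branch_map_simps branches_tree_of[OF g])
next
  case inf
  then show ?thesis by (simp add: branch_map_simps branches_tree_of[OF g])
qed

text \<open>
  Two distinct leaves are always comparable, and the wrong order of the images would contradict
  monotonicity; the branch \<open>1\<^sup>\<nat>\<close> lies to the right of every leaf.
\<close>

lemma branch_map_left_of:
  assumes mono: "strict_mono_on {0..1} f" and f: "locally_dyadic f"
    and inv: "\<And>x. x \<in> {0..1} \<Longrightarrow> f (g x) = x" "\<And>x. x \<in> {0..1} \<Longrightarrow> g (f x) = x"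
    and b: "b \<in> branches (tree_of f)" and c: "c \<in> branches (tree_of f)" and less: "left_of b c"
  shows "left_of (branch_map f b) (branch_map f c)"
  using b f
proof (cases rule: branch_of_tree_cases)
  case inf
  then show ?thesis using less not_left_of_all_True by simp
next
  case p: (fin p p')
  show ?thesis
    using c f
  proof (cases rule: branch_of_tree_cases)
    case inf
    then show ?thesis
      using p left_of_all_True[of p'] unfolding affine_on_def by (simp add: branch_map_simps(1) branch_map_simps(2)[OF p(3)])
  next
    case q: (fin q q')
    have less': "lower p + 1 / 2 ^ length p \<le> lower q"
      using less p(1) q(1) left_of_interval_le by simp
    have "f (lower p + 1 / 2 ^ length p) \<le> f (lower q)"
      using interval_point[of 1 p] interval_point[of 0 q]
      by (intro strict_mono_on_leD[OF mono _ _ less']) simp_all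
    then have ends: "lower p' + 1 / 2 ^ length p' \<le> lower q'"
      using affine_on_upper[OF p(3)] affine_on_lower[OF q(3)] by simp
    have pos: "(0::real) < 1 / 2 ^ length p'" "(0::real) < 1 / 2 ^ length q'" by simp_all
    have "p' \<noteq> q'"
    proof
      assume "p' = q'"
      then have "lower q' + 1 / 2 ^ length q' \<le> lower q'" using ends by (simp only:)
      then show False using pos(2) by linarith
    qed
    moreover have "\<not> left_of (FinBranch q') (FinBranch p')"
    proof
      assume "left_of (FinBranch q') (FinBranch p')"
      from left_of_interval_le[OF this] show False using ends pos by linarith
    qed
    ultimately have "left_of (FinBranch p') (FinBranch q')"
      using minimal_words_left_or_right[OF minimal_words_affine_image[OF p(2,3) inv]
          minimal_words_affine_image[OF q(2,3) inv]] by blast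
    then show ?thesis using p q by (simp add: branch_map_simps)
  qed
qed

text \<open>
  The pair of trees belonging to \<open>f\<close> and to its inverse \<open>g\<close>, with the correspondence of their leaves,
  is a triple that induces \<open>f\<close>.
\<close>

theorem locally_dyadic_in_F_group:
  assumes f: "f \<in> homeo_unit" and mono: "strict_mono_on {0..1} f" and f1: "f 1 = 1"
    and inv: "\<And>x. x \<in> {0..1} \<Longrightarrow> f (g x) = x" "\<And>x. x \<in> {0..1} \<Longrightarrow> g (f x) = x"
    and dyadic_f: "locally_dyadic f" and dyadic_g: "locally_dyadic g"
  shows "f \<in> carrier F_group"
proof -
  have inf: "inf_branches (tree_of f) = {InfBranch (\<lambda>_. True)}"
    "inf_branches (tree_of g) = {InfBranch (\<lambda>_. True)}"
    unfolding tree_of_def using dyadic_f dyadic_g by (simp_all add: inf_branches_affine_domain)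
  have full: "full_binary_tree (tree_of f)" "full_binary_tree (tree_of g)"
    unfolding tree_of_def by (simp_all add: full_binary_tree_with_leaves)
  have bij: "bij_betw (branch_map f) (branches (tree_of f)) (branches (tree_of g))"
    using branch_map_inverse[OF _ dyadic_f dyadic_g inv]
      branch_map_inverse[OF _ dyadic_g dyadic_f inv(2,1)]
    by (intro bij_betw_byWitness[where f' = "branch_map g"]) blast+
  have "tree_triple (tree_of f) (tree_of g) (branch_map f)"
    unfolding tree_triple_def inf
    using bij full branch_map_left_of[OF mono dyadic_f inv] by (simp add: branch_map_simps)
  moreover have "induces (tree_of f) (branch_map f) f"
    unfolding induces_def interpolate_eq
  proof (intro conjI allI impI ballI)
    fix p q and t :: real
    assume pq: "FinBranch p \<in> branches (tree_of f) \<and> branch_map f (FinBranch p) = FinBranch q"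
      and t: "t \<in> {0..1}"
    from pq obtain q' where q': "affine_on f p q'"
      using branch_of_tree_cases[OF _ dyadic_f, of "FinBranch p"] by blast
    then have "q = q'" using pq by (simp add: branch_map_simps)
    then show "f (lower p + t / 2 ^ length p) = lower q + t / 2 ^ length q"
      using q' t by (simp add: affine_on_def)
  next
    fix \<omega> \<eta>
    assume \<omega>: "InfBranch \<omega> \<in> branches (tree_of f) \<and> branch_map f (InfBranch \<omega>) = InfBranch \<eta>"
    then have "\<omega> = (\<lambda>_. True)"
      using branch_of_tree_cases[OF _ dyadic_f, of "InfBranch \<omega>"] by blast
    moreover have "\<eta> = \<omega>" using \<omega> by (simp add: branch_map_simps)
    moreover have "bin_value (\<lambda>_. True) = 1"
      using upper_eq[of "[]"] by (simp add: upper_def append_const_def)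
    ultimately show "f (bin_value \<omega>) = bin_value \<eta>" using f1 by simp
  qed
  ultimately have "\<exists>T S \<phi>. tree_triple T S \<phi> \<and> induces T \<phi> f" by blast
  then show ?thesis
    using f by (simp add: F_group_def Homeo_unit_def)
qed

section \<open>From the half-line to the unit interval\<close>

text \<open>
  The piecewise affine homeomorphism from \<open>[0,\<infinity>)\<close> onto \<open>[0,1)\<close> that maps the cell \<open>[n, n+1]\<close> onto the
  interval \<open>[1\<^sup>n0] = [1 - 2\<^sup>-\<^sup>n, 1 - 2\<^sup>-\<^sup>n\<^sup>-\<^sup>1]\<close>.
\<close>

definition squash :: "real \<Rightarrow> real" where
  "squash x = 1 - (1 - frac x / 2) / 2 ^ nat \<lfloor>x\<rfloor>"

text \<open>
  The cells are closed: the formulas for neighbouring cells agree at the common endpoint, and dyadic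
  intervals may reach that endpoint.
\<close>

lemma squash_cell:
  assumes "x \<in> {real n..real n + 1}"
  shows "squash x = 1 - (1 - (x - real n) / 2) / 2 ^ n"
proof (cases "x = real n + 1")
  case True
  then have "nat \<lfloor>x\<rfloor> = Suc n" "frac x = 0" by (linarith, simp add: frac_def)
  then show ?thesis using True by (simp add: squash_def)
next
  case False
  then have "\<lfloor>x\<rfloor> = int n" using assms by (simp add: floor_eq_iff)
  then show ?thesis by (simp add: squash_def frac_def)
qed

lemma nat_floor_cell:
  assumes "0 \<le> x"
  obtains n where "real n \<le> x" "x < real n + 1"
  using assms by (intro that[of "nat \<lfloor>x\<rfloor>"]) linarith+

lemma squash_strict_mono: "strict_mono_on {0..} squash"
proof (rule strict_mono_onI)
  fix x y :: real
  assume x: "x \<in> {0..}" and y: "y \<in> {0..}" and xy: "x < y"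
  obtain n where n: "real n \<le> x" "x < real n + 1" using nat_floor_cell x by auto
  obtain m where m: "real m \<le> y" "y < real m + 1" using nat_floor_cell y by auto
  have sx: "squash x = 1 - (1 - (x - real n) / 2) / 2 ^ n"
    using n by (intro squash_cell) simp
  show "squash x < squash y"
  proof (cases "y \<le> real n + 1")
    case True
    then have "squash y = 1 - (1 - (y - real n) / 2) / 2 ^ n"
      using n xy by (intro squash_cell) simp
    then show ?thesis using sx xy by (simp add: divide_less_cancel)
  next
    case False
    then have nm: "Suc n \<le> m" using m by linarith
    have "(1 / 2) / 2 ^ n < (1 - (x - real n) / 2) / 2 ^ n"
      using n by (intro divide_strict_right_mono) simp_all
    then have "squash x < 1 - (1 / 2) / 2 ^ n" using sx by linarith
    also have "\<dots> = 1 - 1 / 2 ^ Suc n" by simp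
    also have "\<dots> \<le> 1 - 1 / 2 ^ m"
      using nm by (simp add: frac_le power_increasing del: power_Suc)
    also have "\<dots> \<le> 1 - (1 - (y - real m) / 2) / 2 ^ m"
      using m by (simp add: divide_le_cancel)
    also have "\<dots> = squash y"
      using m by (intro squash_cell[symmetric]) simp
    finally show ?thesis .
  qed
qed

lemma bij_betw_squash: "bij_betw squash {0..} {0..<1}"
  unfolding bij_betw_def
proof (intro conjI subset_antisym subsetI)
  show "inj_on squash {0..}" by (rule strict_mono_on_imp_inj_on[OF squash_strict_mono])
next
  fix y assume "y \<in> squash ` {0..}"
  then obtain x where x: "0 \<le> x" "y = squash x" by auto
  have "squash 0 = 0" by (simp add: squash_def)
  then have "0 \<le> squash x"
    using strict_mono_on_leD[OF squash_strict_mono, of 0 x] x by simp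
  moreover have "squash x < 1"
    using frac_lt_1[of x] by (simp add: squash_def)
  ultimately show "y \<in> {0..<1}" using x by simp
next
  fix y :: real assume y: "y \<in> {0..<1}"
  obtain m where "(1/2) ^ m < 1 - y"
    using real_arch_pow_inv[of "1 - y" "1/2"] y by auto
  then have ex: "\<exists>m. (1/2) ^ Suc m < 1 - y"
    by (intro exI[of _ m]) (use zero_less_power[of "1/2::real" m] in \<open>simp add: field_simps\<close>)
  \<comment> \<open>The cell of the preimage: \<open>y\<close> lies in \<open>[1\<^sup>n0]\<close> iff \<open>2\<^sup>-\<^sup>n\<^sup>-\<^sup>1 < 1 - y \<le> 2\<^sup>-\<^sup>n\<close>.\<close>
  define n where "n = (LEAST n. (1/2) ^ Suc n < 1 - y)"
  have lt: "(1/2) ^ Suc n < 1 - y"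
    unfolding n_def using ex by (rule LeastI_ex)
  have le: "1 - y \<le> (1/2) ^ n"
  proof (cases n)
    case 0
    then show ?thesis using y by simp
  next
    case (Suc m)
    then have "\<not> (1/2) ^ Suc m < 1 - y" unfolding n_def by (intro not_less_Least) simp
    then show ?thesis using Suc by simp
  qed
  define z where "z = (1 - y) * 2 ^ n"
  have z: "1 / 2 < z" "z \<le> 1"
    using lt le by (simp_all add: z_def power_one_over field_simps)
  have "squash (real n + 2 * (1 - z)) = 1 - z / 2 ^ n"
    using z by (subst squash_cell[of _ n]) (auto simp: diff_divide_distrib)
  also have "\<dots> = y" by (simp add: z_def)
  finally show "y \<in> squash ` {0..}"
    using z by (intro image_eqI[where x = "real n + 2 * (1 - z)"]) auto
qed

definition unsquash :: "real \<Rightarrow> real" where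
  "unsquash = inv_into {0..} squash"

definition transport :: "(real \<Rightarrow> real) \<Rightarrow> real \<Rightarrow> real" where
  "transport h = (\<lambda>y\<in>{0..1}. if y < 1 then squash (h (unsquash y)) else 1)"

lemma squash_range: "0 \<le> x \<Longrightarrow> squash x \<in> {0..<1}"
  using bij_betwE[OF bij_betw_squash] by simp

lemma transport_1: "transport h 1 = 1"
  by (simp add: transport_def)

lemma transport_squash:
  assumes "0 \<le> x"
  shows "transport h (squash x) = squash (h x)"
proof -
  have "unsquash (squash x) = x"
    unfolding unsquash_def using assms bij_betw_squash
    by (intro inv_into_f_f) (auto simp: bij_betw_def)
  then show ?thesis using squash_range[OF assms] by (simp add: transport_def)
qed

lemma unit_interval_cases:
  assumes "y \<in> {0..1::real}"
  obtains x where "0 \<le> x" "y = squash x" | "y = 1"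
proof (cases "y = 1")
  case False
  then have "y \<in> squash ` {0..}"
    using assms bij_betw_squash by (simp add: bij_betw_def)
  then show ?thesis using that by auto
qed (use that in blast)

text \<open>
  The word \<open>r\<close> addresses a dyadic interval inside the cell \<open>[n, n+1]\<close>. Taking the same level \<open>k\<close>
  in all cells makes the levels of two maps simply add up under composition.
\<close>

definition dyadic_at_level :: "nat \<Rightarrow> (real \<Rightarrow> real) \<Rightarrow> bool" where
  "dyadic_at_level k h \<longleftrightarrow> (\<forall>n r. length r = k \<longrightarrow> (\<exists>m s. \<forall>t\<in>{0..1}.
     h (real n + lower r + t / 2 ^ k) = real m + lower s + t / 2 ^ length s))"

definition uniformly_dyadic :: "(real \<Rightarrow> real) \<Rightarrow> bool" where
  "uniformly_dyadic h \<longleftrightarrow> strict_mono_on {0..} h \<and> h ` {0..} = {0..} \<and> (\<exists>k. dyadic_at_level k h)"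

text \<open>
  Subdividing the source intervals \<open>l\<close> more times subdivides the images \<open>l\<close> times, so the images
  become at least \<open>l\<close> levels deep and a second map of level \<open>l\<close> is affine on them.
\<close>

lemma dyadic_at_level_refine:
  assumes h: "dyadic_at_level k h" and r: "length r = k + l"
  shows "\<exists>m s. length s \<ge> l \<and> (\<forall>t\<in>{0..1}.
    h (real n + lower r + t / 2 ^ (k + l)) = real m + lower s + t / 2 ^ length s)"
proof -
  define u v where "u = take k r" and "v = drop k r"
  have uv: "r = u @ v" "length u = k" "length v = l" using r by (simp_all add: u_def v_def)
  obtain m s where ms: "\<forall>t\<in>{0..1}. h (real n + lower u + t / 2 ^ k) = real m + lower s + t / 2 ^ length s"
    using h uv(2) unfolding dyadic_at_level_def by blast
  have "h (real n + lower r + t / 2 ^ (k + l)) = real m + lower (s @ v) + t / 2 ^ length (s @ v)"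
    if t: "t \<in> {0..1}" for t
  proof -
    have "h (real n + lower u + (lower v + t / 2 ^ l) / 2 ^ k)
        = real m + lower s + (lower v + t / 2 ^ l) / 2 ^ length s"
      using ms interval_point[OF t, of v] uv(3) by blast
    then show ?thesis
      by (simp add: uv lower_append add_divide_distrib power_add mult.commute add.assoc)
  qed
  then show ?thesis using uv(3) by (intro exI[of _ m] exI[of _ "s @ v"]) simp
qed

lemma dyadic_at_level_comp:
  assumes h: "dyadic_at_level k h" and h': "dyadic_at_level l h'"
  shows "dyadic_at_level (k + l) (h' \<circ> h)"
  unfolding dyadic_at_level_def
proof (intro allI impI)
  fix n and r :: "bool list"
  assume "length r = k + l"
  from dyadic_at_level_refine[OF h this, of n] obtain m s where s: "length s \<ge> l"
    and ms: "\<forall>t\<in>{0..1}. h (real n + lower r + t / 2 ^ (k + l)) = real m + lower s + t / 2 ^ length s"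
    by blast
  have "length s = l + (length s - l)" using s by simp
  from dyadic_at_level_refine[OF h' this, of m] obtain m' s' where
    ms': "\<forall>t\<in>{0..1}. h' (real m + lower s + t / 2 ^ length s) = real m' + lower s' + t / 2 ^ length s'"
    using s by auto
  show "\<exists>m s. \<forall>t\<in>{0..1}. (h' \<circ> h) (real n + lower r + t / 2 ^ (k + l)) = real m + lower s + t / 2 ^ length s"
    using ms ms' by (intro exI[of _ m'] exI[of _ s']) simp
qed

lemma uniformly_dyadic_comp:
  assumes "uniformly_dyadic h" "uniformly_dyadic h'"
  shows "uniformly_dyadic (h' \<circ> h)"
proof -
  have mono: "strict_mono_on {0..} h" "strict_mono_on {0..} h'"
    and im: "h ` {0..} = {0..}" "h' ` {0..} = {0..}"
    using assms by (simp_all add: uniformly_dyadic_def)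
  have "strict_mono_on {0..} (h' \<circ> h)"
  proof (rule strict_mono_onI)
    fix x y :: real
    assume xy: "x \<in> {0..}" "y \<in> {0..}" "x < y"
    then have "h x < h y" "h x \<in> {0..}" "h y \<in> {0..}"
      using strict_mono_onD[OF mono(1)] im(1) by blast+
    then show "(h' \<circ> h) x < (h' \<circ> h) y" using strict_mono_onD[OF mono(2)] by simp
  qed
  moreover have "(h' \<circ> h) ` {0..} = {0..}" using im by (simp only: image_comp[symmetric])
  moreover have "\<exists>k. dyadic_at_level k (h' \<circ> h)"
    using assms dyadic_at_level_comp unfolding uniformly_dyadic_def by blast
  ultimately show ?thesis by (simp add: uniformly_dyadic_def)
qed

lemma uniformly_dyadic_id: "uniformly_dyadic id"
proof -
  have "dyadic_at_level 0 id"
    unfolding dyadic_at_level_def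
  proof (intro allI impI)
    fix n and r :: "bool list"
    assume "length r = 0"
    then show "\<exists>m s. \<forall>t\<in>{0..1}. id (real n + lower r + t / 2 ^ 0) = real m + lower s + t / 2 ^ length s"
      by (intro exI[of _ n] exI[of _ "[]"]) simp
  qed
  then show ?thesis by (auto simp: uniformly_dyadic_def strict_mono_on_def)
qed

lemma lower_replicate_True: "lower (replicate n True) = 1 - 1 / 2 ^ n"
  by (induction n) (auto simp: field_simps)

text \<open>
  The dyadic intervals inside the cell \<open>[n, n+1]\<close> are exactly the intervals addressed by words that
  begin with \<open>1\<^sup>n0\<close>.
\<close>

lemma squash_dyadic_interval:
  assumes "t \<in> {0..1}"
  shows "squash (real n + lower r + t / 2 ^ length r)
    = lower (replicate n True @ False # r) + t / 2 ^ length (replicate n True @ False # r)"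
proof -
  have "squash (real n + lower r + t / 2 ^ length r) = 1 - (1 - (lower r + t / 2 ^ length r) / 2) / 2 ^ n"
    using interval_point[OF assms, of r] by (subst squash_cell[of _ n]) auto
  then show ?thesis
    by (simp add: lower_append lower_replicate_True power_add diff_divide_distrib
        add_divide_distrib mult.commute mult.left_commute)
qed

text \<open>
  An infinite word other than \<open>1\<^sup>\<nat>\<close> begins with some \<open>1\<^sup>n0\<close>; its next \<open>k\<close> letters select a dyadic interval of
  level \<open>k\<close> in the cell \<open>[n, n+1]\<close>.
\<close>

lemma locally_dyadic_transport:
  assumes "dyadic_at_level k h"
  shows "locally_dyadic (transport h)"
  unfolding locally_dyadic_def
proof (intro allI impI)
  fix \<omega> :: "nat \<Rightarrow> bool"
  assume ex: "\<exists>n. \<not> \<omega> n"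
  define n where "n = (LEAST n. \<not> \<omega> n)"
  have n: "\<not> \<omega> n" unfolding n_def by (rule LeastI_ex[OF ex])
  have before_n: "\<omega> i" if "i < n" for i
    using not_less_Least[of i "\<lambda>n. \<not> \<omega> n"] that unfolding n_def by simp
  define r where "r = map \<omega> [Suc n..<Suc n + k]"
  have "[0..<Suc n + k] = [0..<n] @ n # [Suc n..<Suc n + k]"
    using upt_add_eq_append[of 0 n "Suc k"] upt_conv_Cons[of n "Suc n + k"] by simp
  moreover have "map \<omega> [0..<n] = replicate n True"
    using before_n by (intro nth_equalityI) auto
  ultimately have word: "map \<omega> [0..<Suc n + k] = replicate n True @ False # r"
    using n by (simp add: r_def)
  have r: "length r = k" by (simp add: r_def)
  obtain m s where
    ms: "\<forall>t\<in>{0..1}. h (real n + lower r + t / 2 ^ k) = real m + lower s + t / 2 ^ length s"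
    using assms r unfolding dyadic_at_level_def by blast
  have image: "transport h (lower (replicate n True @ False # r) + t / 2 ^ length (replicate n True @ False # r))
      = lower (replicate m True @ False # s) + t / 2 ^ length (replicate m True @ False # s)"
    if t: "t \<in> {0..1}" for t
  proof -
    define x where "x = real n + lower r + t / 2 ^ length r"
    have "0 \<le> x"
      using interval_point[OF t, of r] by (simp add: x_def)
    then have "transport h (squash x) = squash (h x)" by (rule transport_squash)
    also have "h x = real m + lower s + t / 2 ^ length s"
      using ms t unfolding x_def r by (rule bspec)
    finally show ?thesis unfolding x_def squash_dyadic_interval[OF t] .
  qed
  have "affine_on (transport h) (map \<omega> [0..<Suc n + k]) (replicate m True @ False # s)"
    unfolding affine_on_def word by (intro conjI ballI image) simp_all
  then show "\<exists>j. map \<omega> [0..<j] \<in> affine_domain (transport h)"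
    unfolding affine_domain_def by blast
qed

lemma transport_strict_mono:
  assumes "strict_mono_on {0..} h" "h ` {0..} = {0..}"
  shows "strict_mono_on {0..1} (transport h)"
proof (rule strict_mono_onI)
  fix x y :: real
  assume x: "x \<in> {0..1}" and y: "y \<in> {0..1}" and xy: "x < y"
  obtain u where u: "0 \<le> u" "x = squash u"
    using x
  proof (cases rule: unit_interval_cases)
    case 2
    then show ?thesis using xy y by simp
  qed
  have hu: "0 \<le> h u" using u assms(2) by auto
  show "transport h x < transport h y"
    using y
  proof (cases rule: unit_interval_cases)
    case (1 v)
    have "u < v"
      using strict_mono_on_less[OF squash_strict_mono, of u v] u 1 xy by simp
    then have "h u < h v" using strict_mono_onD[OF assms(1)] u 1 by simp
    then have "squash (h u) < squash (h v)"
      using strict_mono_onD[OF squash_strict_mono] hu by simp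
    then show ?thesis using u 1 by (simp add: transport_squash)
  next
    case 2
    then show ?thesis using u squash_range[OF hu] by (simp add: transport_squash transport_1)
  qed
qed

lemma transport_image:
  assumes "h ` {0..} = {0..}"
  shows "transport h ` {0..1} = {0..1}"
proof (intro subset_antisym subsetI)
  fix y assume "y \<in> transport h ` {0..1}"
  then obtain x where x: "x \<in> {0..1}" "y = transport h x" by blast
  show "y \<in> {0..1}"
    using x(1)
  proof (cases rule: unit_interval_cases)
    case (1 u)
    then have "0 \<le> h u" using assms by auto
    then show ?thesis using x 1 squash_range[of "h u"] by (simp add: transport_squash)
  qed (simp add: x transport_1)
next
  fix y :: real assume "y \<in> {0..1}"
  then show "y \<in> transport h ` {0..1}"
  proof (cases rule: unit_interval_cases)
    case (1 v)
    then have "v \<in> h ` {0..}" using assms by simp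
    then obtain u where u: "0 \<le> u" "v = h u" by auto
    then show ?thesis
      using 1 squash_range[of u]
      by (intro image_eqI[where x = "squash u"]) (simp_all add: transport_squash)
  next
    case 2
    then show ?thesis by (intro image_eqI[where x = 1]) (simp_all add: transport_1)
  qed
qed

lemma transport_homeo_unit:
  assumes "uniformly_dyadic h"
  shows "transport h \<in> homeo_unit"
  using assms transport_strict_mono[of h] transport_image[of h] unfolding uniformly_dyadic_def
  by (intro strict_mono_surj_imp_homeo_unit) (simp add: transport_def, blast+)

lemma transport_comp:
  assumes "h ` {0..} = {0..}"
  shows "transport (h' \<circ> h) = compose {0..1} (transport h') (transport h)"
proof
  fix y
  show "transport (h' \<circ> h) y = compose {0..1} (transport h') (transport h) y"
  proof (cases "y \<in> {0..1}")
    case True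
    then show ?thesis
    proof (cases rule: unit_interval_cases)
      case (1 u)
      then have "0 \<le> h u" using assms by auto
      then show ?thesis using True 1 by (simp add: compose_eq transport_squash)
    next
      case 2
      then show ?thesis by (simp add: compose_eq transport_1)
    qed
  next
    case False
    then show ?thesis by (simp only: transport_def compose_def restrict_apply if_False)
  qed
qed

lemma transport_eq_id:
  assumes "\<And>x. 0 \<le> x \<Longrightarrow> h x = x"
  shows "transport h = (\<lambda>y\<in>{0..1}. y)"
proof
  fix y
  show "transport h y = (\<lambda>y\<in>{0..1}. y) y"
  proof (cases "y \<in> {0..1}")
    case True
    then have "transport h y = y"
      using assms by (cases rule: unit_interval_cases) (simp_all add: transport_squash transport_1)
    then show ?thesis using True by simp
  next
    case False
    then show ?thesis by (simp only: transport_def restrict_apply if_False)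
  qed
qed

lemma transport_mult:
  assumes "uniformly_dyadic h" "uniformly_dyadic h'"
  shows "transport h' \<otimes>\<^bsub>Homeo_unit\<^esub> transport h = transport (h' \<circ> h)"
proof -
  have "transport h \<in> Bij {0..1}" "transport h' \<in> Bij {0..1}"
    using transport_homeo_unit[OF assms(1)] transport_homeo_unit[OF assms(2)] homeo_unit_subset_Bij by blast+
  then show ?thesis
    using assms(1) by (simp add: Homeo_unit_def BijGroup_def transport_comp uniformly_dyadic_def)
qed

lemma one_Homeo_unit: "\<one>\<^bsub>Homeo_unit\<^esub> = (\<lambda>y\<in>{0..1}. y)"
  by (simp add: Homeo_unit_def BijGroup_def)

lemma transport_inverse:
  assumes "uniformly_dyadic h" "uniformly_dyadic h'" "h' \<circ> h = id"
  shows "inv\<^bsub>Homeo_unit\<^esub> (transport h) = transport h'"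
proof (rule group.inv_equality[OF group_Homeo_unit])
  show "transport h' \<otimes>\<^bsub>Homeo_unit\<^esub> transport h = \<one>\<^bsub>Homeo_unit\<^esub>"
    using assms by (simp add: transport_mult one_Homeo_unit transport_eq_id)
qed (use assms transport_homeo_unit in \<open>simp_all add: Homeo_unit_def\<close>)

theorem transport_in_F_group:
  assumes h: "uniformly_dyadic h" and h': "uniformly_dyadic h'"
    and inv: "h \<circ> h' = id" "h' \<circ> h = id"
  shows "transport h \<in> carrier F_group"
proof (rule locally_dyadic_in_F_group[where g = "transport h'"])
  have inverse: "transport k (transport k' x) = x"
    if k': "uniformly_dyadic k'" and kk': "k \<circ> k' = id" and x: "x \<in> {0..1}" for k k' x
  proof -
    have "compose {0..1} (transport k) (transport k') = transport (k \<circ> k')"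
      using transport_comp[of k' k] k' by (simp add: uniformly_dyadic_def)
    also have "\<dots> = (\<lambda>y\<in>{0..1}. y)" unfolding kk' by (rule transport_eq_id) simp
    finally have "compose {0..1} (transport k) (transport k') x = x" using x by simp
    then show ?thesis using x by (simp add: compose_eq)
  qed
  show "transport h (transport h' x) = x" "transport h' (transport h x) = x" if "x \<in> {0..1}" for x
    using inverse[OF h' inv(1) that] inverse[OF h inv(2) that] .
  show "locally_dyadic (transport h)" "locally_dyadic (transport h')"
    using h h' by (auto simp: uniformly_dyadic_def intro: locally_dyadic_transport)
qed (use h transport_homeo_unit transport_strict_mono transport_1 in \<open>simp_all add: uniformly_dyadic_def\<close>)

section \<open>Two bumps playing ping-pong\<close>

text \<open>
  One period of the bump, as the minimum or maximum of its two affine pieces: slopes \<open>4\<close>, \<open>1/4\<close>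
  with the break at \<open>y = 1\<close> for \<open>d = True\<close>, and the inverse map, which breaks at \<open>y = 4\<close>, for \<open>d = False\<close>. With period \<open>5\<close>,
  exchanging the roles of one cell and of the \<open>5 - 1 = 2\<^sup>2\<close> others takes slopes that are powers of two.
\<close>

definition fragment :: "bool \<Rightarrow> real \<Rightarrow> real" where
  "fragment d y = (if d then min (4 * y) ((y + 15) / 4) else max (y / 4) (4 * y - 15))"

definition bump :: "bool \<Rightarrow> real \<Rightarrow> real" where
  "bump d x = (if x < 0 then x
     else 5 * of_int \<lfloor>x / 5\<rfloor> + fragment d (x - 5 * of_int \<lfloor>x / 5\<rfloor>))"

definition generator :: "nat \<times> bool \<Rightarrow> real \<Rightarrow> real" where
  "generator a x = real (fst a) + bump (snd a) (x - real (fst a))"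

definition play :: "(nat \<times> bool) list \<Rightarrow> real \<Rightarrow> real" where
  "play w = foldr (\<lambda>a h. generator a \<circ> h) w id"

lemma fragment_range:
  "0 \<le> y \<Longrightarrow> 0 \<le> fragment d y" "y < 5 \<Longrightarrow> fragment d y < 5"
  by (auto simp: fragment_def min_def max_def)

lemma fragment_inverse: "fragment (\<not> d) (fragment d y) = y"
  by (auto simp: fragment_def min_def max_def field_simps)

lemma fragment_strict_mono: "y < z \<Longrightarrow> fragment d y < fragment d z"
  by (auto simp: fragment_def min_def max_def)

lemma bump_eq:
  assumes "0 \<le> y" "y \<le> 5"
  shows "bump d (5 * real m + y) = 5 * real m + fragment d y"
proof (cases "y = 5")
  case True
  have "\<lfloor>(5 * real m + y) / 5\<rfloor> = int m + 1"
    using True by (intro floor_unique) simp_all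
  then show ?thesis using True by (simp add: bump_def fragment_def)
next
  case False
  then have "\<lfloor>(5 * real m + y) / 5\<rfloor> = int m"
    using assms by (intro floor_unique) simp_all
  then show ?thesis using assms by (simp add: bump_def)
qed

lemma block_cases:
  assumes "0 \<le> (x :: real)"
  obtains m y where "x = 5 * real m + y" "0 \<le> y" "y < 5"
proof -
  define m where "m = nat \<lfloor>x / 5\<rfloor>"
  have "real m \<le> x / 5" "x / 5 < real m + 1"
    using assms unfolding m_def by linarith+
  then show ?thesis by (intro that[of m "x - 5 * real m"]) simp_all
qed

lemma bump_bounds:
  "0 \<le> x \<Longrightarrow> 0 \<le> bump d x"
  "x - 5 \<le> bump d x"
proof -
  have "0 \<le> bump d x \<and> x - 5 \<le> bump d x" if "0 \<le> x"
    using that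
  proof (cases rule: block_cases)
    case (1 m y)
    then show ?thesis using fragment_range(1)[of y d] by (simp add: bump_eq)
  qed
  then show "0 \<le> x \<Longrightarrow> 0 \<le> bump d x" "x - 5 \<le> bump d x"
    by (blast, cases "0 \<le> x") (simp_all add: bump_def)
qed

lemma bump_inverse: "bump (\<not> d) (bump d x) = x"
proof (cases "0 \<le> x")
  case True
  then show ?thesis
  proof (cases rule: block_cases)
    case (1 m y)
    then show ?thesis
      using fragment_range[of y d] by (simp add: bump_eq fragment_inverse)
  qed
qed (simp add: bump_def)

lemma bump_strict_mono: "x < y \<Longrightarrow> bump d x < bump d y"
proof -
  assume xy: "x < y"
  show ?thesis
  proof (cases "0 \<le> x")
    case False
    then show ?thesis using xy bump_bounds(1)[of y d] by (cases "0 \<le> y") (simp_all add: bump_def)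
  next
    case True
    obtain m u where u: "x = 5 * real m + u" "0 \<le> u" "u < 5"
      using block_cases[OF True] by metis
    have "0 \<le> y" using True xy by simp
    then obtain n v where v: "y = 5 * real n + v" "0 \<le> v" "v < 5"
      by (metis block_cases)
    have eq: "bump d x = 5 * real m + fragment d u" "bump d y = 5 * real n + fragment d v"
      using u v by (simp_all add: bump_eq)
    show ?thesis
    proof (cases "m = n")
      case True
      then show ?thesis using eq u(1) v(1) xy fragment_strict_mono[of u v d] by simp
    next
      case False
      have "m < Suc n"
        using u v xy by linarith
      then have "5 * real m + 5 \<le> 5 * real n" using False by linarith
      then show ?thesis
        using eq fragment_range(2)[OF u(3), of d] fragment_range(1)[OF v(2), of d] by linarith
    qed
  qed
qed

lemma two_bits:
  assumes "e < (4::nat)"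
  obtains u where "length u = 2" "lower u = real e / 4"
proof -
  have "e = 0 \<or> e = 1 \<or> e = 2 \<or> e = 3" using assms by auto
  then show ?thesis
    using that[of "[False, False]"] that[of "[False, True]"] that[of "[True, False]"] that[of "[True, True]"]
    by auto
qed

text \<open>
  Quarters of cells are small enough: both breaks are integers, a quarter of a cell stretched by \<open>4\<close> is a full
  cell, and shrunk by \<open>4\<close> it is a sixteenth of a cell whose address is the two-bit number of the
  cell followed by \<open>r\<close>.
\<close>

lemma fragment_dyadic:
  assumes e: "e < 5" and r: "length r = 2"
  shows "\<exists>m s. \<forall>t\<in>{0..1}. fragment d (real e + lower r + t / 2 ^ 2) = real m + lower s + t / 2 ^ length s"
proof -
  obtain a b where ab: "r = [a, b]"
    using r by (auto simp: numeral_2_eq_2 length_Suc_conv)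
  have four: "4 * lower r = real (2 * of_bool a + of_bool b)" by (simp add: ab)
  have unit: "0 \<le> lower r + t / 4 \<and> lower r + t / 4 \<le> 1" if "t \<in> {0..1}" for t
    using interval_point[OF that, of r] r by simp
  consider "d" "e = 0" | "d" "e > 0" | "\<not> d" "e = 4" | "\<not> d" "e < 4" using e by linarith
  then show ?thesis
  proof cases
    case 1
    show ?thesis
    proof (intro exI ballI)
      fix t :: real assume t: "t \<in> {0..1}"
      show "fragment d (real e + lower r + t / 2 ^ 2)
          = real (2 * of_bool a + of_bool b) + lower [] + t / 2 ^ length ([] :: bool list)"
        using 1 unit[OF t] four by (simp add: fragment_def)
    qed
  next
    case 2
    obtain u where u: "length u = 2" "lower u = real (e - 1) / 4"
      using two_bits[of "e - 1"] e 2 by force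
    show ?thesis
    proof (intro exI ballI)
      fix t :: real assume t: "t \<in> {0..1}"
      have "1 \<le> real e" using 2 by simp
      then show "fragment d (real e + lower r + t / 2 ^ 2)
          = real 4 + lower (u @ r) + t / 2 ^ length (u @ r)"
        using 2 unit[OF t] u r by (simp add: fragment_def lower_append of_nat_diff field_simps)
    qed
  next
    case 3
    show ?thesis
    proof (intro exI ballI)
      fix t :: real assume t: "t \<in> {0..1}"
      show "fragment d (real e + lower r + t / 2 ^ 2)
          = real (1 + 2 * of_bool a + of_bool b) + lower [] + t / 2 ^ length ([] :: bool list)"
        using 3 unit[OF t] four by (simp add: fragment_def)
    qed
  next
    case 4
    obtain u where u: "length u = 2" "lower u = real e / 4"
      using two_bits[of e] 4 by force
    show ?thesis
    proof (intro exI ballI)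
      fix t :: real assume t: "t \<in> {0..1}"
      have "real e \<le> 3" using 4 by simp
      then show "fragment d (real e + lower r + t / 2 ^ 2)
          = real 0 + lower (u @ r) + t / 2 ^ length (u @ r)"
        using 4 unit[OF t] u r by (simp add: fragment_def lower_append field_simps)
    qed
  qed
qed

lemma generator_inverse: "generator (j, \<not> d) \<circ> generator (j, d) = id"
  by (auto simp: generator_def bump_inverse)

lemma generator_nonneg:
  assumes "0 \<le> x"
  shows "0 \<le> generator a x"
proof (cases "x < real (fst a)")
  case True
  then show ?thesis using assms by (simp add: generator_def bump_def)
next
  case False
  then show ?thesis using bump_bounds(1)[of "x - real (fst a)"] by (simp add: generator_def)
qed

lemma dyadic_generator: "dyadic_at_level 2 (generator a)"
  unfolding dyadic_at_level_def
proof (intro allI impI)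
  fix n and r :: "bool list" assume r: "length r = 2"
  have unit: "lower r + t / 4 \<in> {0..1}" if "t \<in> {0..1}" for t
    using interval_point[OF that, of r] r by simp
  obtain j d where a: "a = (j, d)" by fastforce
  show "\<exists>m s. \<forall>t\<in>{0..1}. generator a (real n + lower r + t / 2 ^ 2) = real m + lower s + t / 2 ^ length s"
  proof (cases "n < j")
    case True
    have "generator a (real n + lower r + t / 2 ^ 2) = real n + lower r + t / 2 ^ length r"
      if t: "t \<in> {0..1}" for t
    proof -
      have "bump d x = x" if "x \<le> 0" for x
        using that bump_eq[of 0 d 0] by (cases "x = 0") (simp_all add: bump_def fragment_def)
      moreover have "real n + lower r + t / 2 ^ 2 - real j \<le> 0"
        using unit[OF t] True by simp
      ultimately show ?thesis using r by (simp add: generator_def a)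
    qed
    then show ?thesis by blast
  next
    case False
    define m e where "m = (n - j) div 5" and "e = (n - j) mod 5"
    have n: "n = j + 5 * m + e" using False by (simp add: m_def e_def)
    have e: "e < 5" by (simp add: e_def)
    obtain m' s where s: "\<forall>t\<in>{0..1}. fragment d (real e + lower r + t / 2 ^ 2) = real m' + lower s + t / 2 ^ length s"
      using fragment_dyadic[OF e r] by blast
    have "generator a (real n + lower r + t / 2 ^ 2) = real (j + 5 * m + m') + lower s + t / 2 ^ length s"
      if t: "t \<in> {0..1}" for t
    proof -
      have "bump d (5 * real m + (real e + lower r + t / 2 ^ 2))
          = 5 * real m + fragment d (real e + lower r + t / 2 ^ 2)"
        using unit[OF t] e by (intro bump_eq) simp_all
      also have "\<dots> = 5 * real m + (real m' + lower s + t / 2 ^ length s)"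
        using s t by simp
      also have "5 * real m + (real e + lower r + t / 2 ^ 2) = real n + lower r + t / 2 ^ 2 - real j"
        by (simp add: n)
      finally show ?thesis by (simp add: generator_def a)
    qed
    then show ?thesis by blast
  qed
qed

lemma uniformly_dyadic_generator: "uniformly_dyadic (generator a)"
proof -
  obtain j d where a: "a = (j, d)" by fastforce
  have "strict_mono_on {0..} (generator a)"
    by (rule strict_mono_onI) (simp add: generator_def bump_strict_mono)
  moreover have "generator a ` {0..} = {0..}"
  proof (intro subset_antisym subsetI)
    fix y :: real assume "y \<in> {0..}"
    then show "y \<in> generator a ` {0..}"
      using generator_inverse[of j "\<not> d"] generator_nonneg[of y "(j, \<not> d)"]
      by (intro image_eqI[where x = "generator (j, \<not> d) y"]) (simp_all add: a fun_eq_iff)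
  next
    fix y assume "y \<in> generator a ` {0..}"
    then obtain x where "0 \<le> x" "y = generator a x" by (metis atLeast_iff imageE)
    then show "y \<in> {0..}" using generator_nonneg[of x a] by simp
  qed
  ultimately show ?thesis
    using dyadic_generator[of a] unfolding uniformly_dyadic_def by blast
qed

lemma play_simps [simp]: "play [] = id" "play (a # w) = generator a \<circ> play w"
  by (simp_all add: play_def)

text \<open>
  Level and inverse are carried through the same induction, because the criterion for membership in
  \<open>\<F>\<close> asks for uniformly dyadic maps in both directions.
\<close>

lemma play_invertible:
  "uniformly_dyadic (play w) \<and> (\<exists>h. uniformly_dyadic h \<and> play w \<circ> h = id \<and> h \<circ> play w = id)"
proof (induction w)
  case Nil
  show ?case
    unfolding play_simps by (intro conjI exI[of _ id] uniformly_dyadic_id) simp_all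
next
  case (Cons a w)
  obtain j d where a: "a = (j, d)" by fastforce
  obtain h where h: "uniformly_dyadic h" "play w \<circ> h = id" "h \<circ> play w = id"
    using Cons by blast
  have "uniformly_dyadic (play (a # w))"
    using Cons uniformly_dyadic_comp uniformly_dyadic_generator by simp
  moreover have "uniformly_dyadic (h \<circ> generator (j, \<not> d))"
    using h uniformly_dyadic_comp uniformly_dyadic_generator by simp
  moreover have "play (a # w) \<circ> (h \<circ> generator (j, \<not> d)) = id"
    using h(2) generator_inverse[of j "\<not> d"] by (simp add: a fun_eq_iff)
  moreover have "(h \<circ> generator (j, \<not> d)) \<circ> play (a # w) = id"
    using h(3) generator_inverse[of j d] by (simp add: a fun_eq_iff)
  ultimately show ?case by blast
qed

text \<open>
  The unit cell, modulo \<open>5\<close>, to which a letter attracts; the letter repels from the arena of the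
  inverse letter.
\<close>

definition arena :: "nat \<times> bool \<Rightarrow> int" where
  "arena a = (int (fst a) + (if snd a then 4 else 0)) mod 5"

lemma bump_ping_pong:
  assumes x: "0 \<le> x" and outside: "\<lfloor>x\<rfloor> mod 5 \<noteq> (if d then 0 else 4)"
  shows "\<lfloor>bump d x\<rfloor> mod 5 = (if d then 4 else 0)"
  using x
proof (cases rule: block_cases)
  case (1 m y)
  have floor_add: "\<lfloor>5 * real m + z\<rfloor> = 5 * int m + \<lfloor>z\<rfloor>" for z by linarith
  have "\<lfloor>y\<rfloor> \<noteq> (if d then 0 else 4)"
    using outside by (auto simp: 1 floor_add)
  then have y: "if d then 1 \<le> y else y < 4" using 1(2,3) by (auto split: if_splits) linarith+
  have "\<lfloor>fragment d y\<rfloor> = (if d then 4 else 0)"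
    using y 1(2,3) by (auto simp: fragment_def floor_eq_iff split: if_splits)
  then show ?thesis using 1 by (simp add: bump_eq floor_add)
qed

text \<open>
  To the left of \<open>j\<close> the generator is the identity, so the dynamics needs \<open>j \<le> x\<close>.
\<close>

lemma generator_ping_pong:
  assumes x: "real j \<le> x" and outside: "\<lfloor>x\<rfloor> mod 5 \<noteq> arena (j, \<not> d)"
  shows "\<lfloor>generator (j, d) x\<rfloor> mod 5 = arena (j, d)"
proof -
  have floor_diff: "\<lfloor>x - real j\<rfloor> = \<lfloor>x\<rfloor> - int j" by linarith
  have "\<lfloor>x - real j\<rfloor> mod 5 \<noteq> (if d then 0 else 4)"
  proof
    assume "\<lfloor>x - real j\<rfloor> mod 5 = (if d then 0 else 4)"
    then have "\<lfloor>x\<rfloor> mod 5 = (int j + (if d then 0 else 4)) mod 5"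
      unfolding floor_diff by (cases d; simp) presburger+
    then show False using outside by (simp add: arena_def split: if_splits)
  qed
  then have bump: "\<lfloor>bump d (x - real j)\<rfloor> mod 5 = (if d then 4 else 0)"
    using x by (intro bump_ping_pong) simp_all
  have "\<lfloor>generator (j, d) x\<rfloor> mod 5 = (int j + \<lfloor>bump d (x - real j)\<rfloor>) mod 5"
    unfolding generator_def by simp
  also have "\<dots> = (int j + \<lfloor>bump d (x - real j)\<rfloor> mod 5) mod 5"
    by (rule mod_add_right_eq[symmetric])
  finally show ?thesis by (simp only: bump arena_def fst_conv snd_conv)
qed

lemma arena_distinct:
  assumes "a \<in> {0, 2} \<times> UNIV" "b \<in> {0, 2} \<times> UNIV"
  shows "arena a \<noteq> 3" "arena a = arena b \<longleftrightarrow> a = b"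
  using assms by (auto simp: arena_def split: if_splits)

text \<open>
  In a reduced word the letter \<open>a\<close> is never applied to a point in its repelling arena: the point
  lies in the arena of the letter applied just before, which is not the inverse of \<open>a\<close>, or in
  the starting cell \<open>3\<close>. The lower bound keeps the orbit to the right of \<open>2\<close>: each letter
  moves a point by at most \<open>5\<close>.
\<close>

lemma play_ping_pong:
  assumes "w \<in> lists ({0, 2} \<times> UNIV)" "reduced_word w" "length w \<le> N"
  shows "5 * (real N - real (length w)) + 3 \<le> play w (5 * real N + 3) \<and>
    \<lfloor>play w (5 * real N + 3)\<rfloor> mod 5 = (case w of [] \<Rightarrow> 3 | a # _ \<Rightarrow> arena a)"
  using assms
proof (induction w rule: lists.induct)
  case Nil
  have "\<lfloor>5 * real N + 3\<rfloor> = 5 * int N + 3" by linarith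
  then show ?case by simp
next
  case (Cons a w)
  obtain j d where a: "a = (j, d)" by fastforce
  define x where "x = play w (5 * real N + 3)"
  note a_in = Cons.hyps(1) and w = Cons.hyps(2)
  have low: "5 * (real N - real (length w)) + 3 \<le> x"
    and pos: "\<lfloor>x\<rfloor> mod 5 = (case w of [] \<Rightarrow> 3 | b # _ \<Rightarrow> arena b)"
    using Cons.IH[OF reduced_word_ConsD[OF Cons.prems(1)]] Cons.prems(2) by (simp_all add: x_def)
  have inv_in: "(j, \<not> d) \<in> {0, 2} \<times> UNIV" using a_in a by simp
  have outside: "\<lfloor>x\<rfloor> mod 5 \<noteq> arena (j, \<not> d)"
  proof (cases w)
    case Nil
    then show ?thesis using pos arena_distinct(1)[OF inv_in inv_in] by simp
  next
    case (Cons b v)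
    have "b \<in> {0, 2} \<times> UNIV" using w Cons by simp
    moreover have "b \<noteq> (j, \<not> d)"
      using \<open>reduced_word (a # w)\<close> Cons by (auto simp: a cancels_def)
    ultimately show ?thesis using pos Cons arena_distinct(2)[OF _ inv_in, of b] by simp
  qed
  have "real (length w) \<le> real N" "real j \<le> 2" using Cons.prems(2) a_in a by auto
  then have "real j \<le> 5 * (real N - real (length w)) + 3" by simp
  then have "real j \<le> x" using low by (rule order_trans)
  then have "\<lfloor>generator a x\<rfloor> mod 5 = arena a"
    unfolding a using outside by (rule generator_ping_pong)
  moreover have "x - 5 \<le> generator a x"
    using bump_bounds(2)[of "x - real j" d] by (simp add: generator_def a)
  ultimately show ?case using low by (simp add: x_def)
qed

section \<open>The free subgroup\<close>

definition free_generators :: "(real \<Rightarrow> real) set" where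
  "free_generators = (\<lambda>j. transport (generator (j, True))) ` {0, 2}"

lemma transport_generator_letter:
  "letter_value Homeo_unit (transport (generator (j, True)), d) = transport (generator (j, d))"
proof (cases d)
  case False
  have "inv\<^bsub>Homeo_unit\<^esub> (transport (generator (j, True))) = transport (generator (j, False))"
    using generator_inverse[of j True] uniformly_dyadic_generator by (intro transport_inverse) simp_all
  then show ?thesis using False by (simp add: letter_value_def)
qed (simp add: letter_value_def)

lemma word_value_eq_play:
  "word_value Homeo_unit (map (\<lambda>(j, d). (transport (generator (j, True)), d)) w) = transport (play w)"
proof (induction w)
  case Nil
  then show ?case by (simp add: one_Homeo_unit transport_eq_id)
next
  case (Cons a w)
  obtain j d where a: "a = (j, d)" by fastforce
  show ?case
    using Cons transport_mult[of "play w" "generator a"] play_invertible[of w]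
      uniformly_dyadic_generator[of a]
    by (simp add: a transport_generator_letter comp_def)
qed

lemma free_generators_word:
  fixes w :: "((real \<Rightarrow> real) \<times> bool) list"
  assumes "w \<in> lists (free_generators \<times> UNIV)"
  obtains v where "v \<in> lists ({0, 2} \<times> UNIV)" "w = map (\<lambda>(j, d). (transport (generator (j, True)), d)) v"
proof -
  have letters: "free_generators \<times> UNIV
      = (\<lambda>(j, d). (transport (generator (j, True)), d)) ` ({0, 2} \<times> (UNIV :: bool set))"
    unfolding free_generators_def by force
  have "w \<in> map (\<lambda>(j, d). (transport (generator (j, True)), d)) ` lists ({0, 2} \<times> UNIV)"
    using assms unfolding letters lists_image .
  then show ?thesis by (elim imageE) (rule that)
qed

text \<open>
  Renaming generators by a function, injective or not, can only create cancellations.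
\<close>

lemma reduced_word_mapD:
  assumes "reduced_word (map (\<lambda>(j, d). (f j, d)) w)"
  shows "reduced_word w"
  using assms
proof (induction w rule: induct_list012)
  case (3 a b w)
  then show ?case by (cases a; cases b) (auto simp: cancels_def)
qed simp_all

lemma transport_eqD:
  assumes "uniformly_dyadic h" "uniformly_dyadic h'" "transport h = transport h'" "0 \<le> x"
  shows "h x = h' x"
proof -
  have "squash (h x) = squash (h' x)"
    using assms(3,4) transport_squash by metis
  moreover have "h x \<in> {0..}" "h' x \<in> {0..}"
    using assms(1,2,4) unfolding uniformly_dyadic_def by blast+
  ultimately show ?thesis
    using strict_mono_on_imp_inj_on[OF squash_strict_mono] by (simp add: inj_on_eq_iff)
qed

theorem theorem7p9:
  shows "\<exists>H. subgroup H F_group \<and>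
             is_free_group (F_group\<lparr>carrier := H\<rparr>) \<and>
             (\<exists>f \<in> H. \<exists>g \<in> H. f \<otimes>\<^bsub>F_group\<^esub> g \<noteq> g \<otimes>\<^bsub>F_group\<^esub> f)"
proof -
  interpret Homeo: group Homeo_unit by (rule group_Homeo_unit)
  define H where "H = word_value Homeo_unit ` carrier (free_group free_generators)"
  have dyadic: "uniformly_dyadic (play w)" for w using play_invertible by blast
  have generators: "free_generators \<subseteq> carrier Homeo_unit"
    using transport_homeo_unit[OF uniformly_dyadic_generator]
    by (auto simp: free_generators_def Homeo_unit_def)
  have nontrivial: "word_value Homeo_unit w \<noteq> \<one>\<^bsub>Homeo_unit\<^esub>"
    if w: "w \<in> lists (free_generators \<times> UNIV)" "reduced_word w" "w \<noteq> []" for w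
  proof
    assume trivial: "word_value Homeo_unit w = \<one>\<^bsub>Homeo_unit\<^esub>"
    obtain v where v: "v \<in> lists ({0, 2} \<times> UNIV)"
      "w = map (\<lambda>(j, d). (transport (generator (j, True)), d)) v"
      using free_generators_word[OF w(1)] by blast
    have "transport (play v) = transport (play [])"
      using trivial word_value_eq_play[of v] word_value_eq_play[of "[]"] v(2) by simp
    then have fixed: "play v (5 * real (length v) + 3) = 5 * real (length v) + 3"
      using transport_eqD[OF dyadic dyadic, of v "[]"] by simp
    obtain a v' where a: "v = a # v'" using v(2) w(3) by (cases v) auto
    have "reduced_word v"
      using w(2) unfolding v(2) by (rule reduced_word_mapD)
    from play_ping_pong[OF v(1) this, of "length v"]
    have "\<lfloor>play v (5 * real (length v) + 3)\<rfloor> mod 5 = arena a" by (simp add: a)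
    moreover have "\<lfloor>5 * real (length v) + 3\<rfloor> mod 5 = 3"
    proof -
      have "\<lfloor>5 * real (length v) + 3\<rfloor> = 5 * int (length v) + 3" by linarith
      then show ?thesis by simp
    qed
    ultimately have "arena a = 3" using fixed by simp
    then show False using arena_distinct(1)[of a a] v(1) a by simp
  qed
  have H: "subgroup H Homeo_unit" and free: "is_free_group (Homeo_unit\<lparr>carrier := H\<rparr>)"
    unfolding H_def using Homeo.free_subgroup_if_no_relations[OF generators nontrivial] by blast+
  have H_subset: "H \<subseteq> carrier F_group"
  proof
    fix f assume "f \<in> H"
    then obtain w where w: "w \<in> lists (free_generators \<times> UNIV)" "f = word_value Homeo_unit w"
      unfolding H_def free_group_def by auto
    obtain v where "w = map (\<lambda>(j, d). (transport (generator (j, True)), d)) v"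
      using free_generators_word[OF w(1)] by blast
    then have "f = transport (play v)" using w(2) word_value_eq_play by simp
    then show "f \<in> carrier F_group"
      using play_invertible[of v] transport_in_F_group by blast
  qed
  have mult: "mult F_group = mult Homeo_unit" and one: "\<one>\<^bsub>F_group\<^esub> = \<one>\<^bsub>Homeo_unit\<^esub>"
    by (simp_all add: F_group_def)
  have F_subset: "carrier F_group \<subseteq> carrier Homeo_unit" by (auto simp: F_group_def)
  have "subgroup H F_group"
  proof
    show "H \<subseteq> carrier F_group" by (rule H_subset)
    show "f \<otimes>\<^bsub>F_group\<^esub> g \<in> H" if "f \<in> H" "g \<in> H" for f g
      using subgroup.m_closed[OF H that] by (simp add: mult)
    show "\<one>\<^bsub>F_group\<^esub> \<in> H" using subgroup.one_closed[OF H] by (simp add: one)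
    show "inv\<^bsub>F_group\<^esub> f \<in> H" if f: "f \<in> H" for f
    proof -
      let ?g = "inv\<^bsub>Homeo_unit\<^esub> f"
      have g: "?g \<in> H" by (rule subgroup.m_inv_closed[OF H f])
      have carrier: "f \<in> carrier Homeo_unit" using f H_subset F_subset by blast
      \<comment> \<open>An inverse with respect to the smaller carrier is also an inverse in the ambient group, where it is unique.\<close>
      have "inv\<^bsub>F_group\<^esub> f = ?g"
        unfolding m_inv_def[of F_group] mult one
      proof (rule the_equality)
        show "?g \<in> carrier F_group \<and> f \<otimes>\<^bsub>Homeo_unit\<^esub> ?g = \<one>\<^bsub>Homeo_unit\<^esub> \<and>
            ?g \<otimes>\<^bsub>Homeo_unit\<^esub> f = \<one>\<^bsub>Homeo_unit\<^esub>"
          using g H_subset carrier by (simp add: subset_iff)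
        show "k = ?g" if "k \<in> carrier F_group \<and> f \<otimes>\<^bsub>Homeo_unit\<^esub> k = \<one>\<^bsub>Homeo_unit\<^esub> \<and>
            k \<otimes>\<^bsub>Homeo_unit\<^esub> f = \<one>\<^bsub>Homeo_unit\<^esub>" for k
          using that F_subset carrier Homeo.inv_equality[of k f] by blast
      qed
      then show ?thesis using g by simp
    qed
  qed
  moreover have "is_free_group (F_group\<lparr>carrier := H\<rparr>)"
    using free by (simp add: F_group_def)
  moreover have "\<exists>f \<in> H. \<exists>g \<in> H. f \<otimes>\<^bsub>F_group\<^esub> g \<noteq> g \<otimes>\<^bsub>F_group\<^esub> f"
  proof -
    have in_H: "transport (generator (j, True)) \<in> H" if "j \<in> {0, 2}" for j
    proof -
      have "[(transport (generator (j, True)), True)] \<in> carrier (free_group free_generators)"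
        using that by (auto simp: free_group_def free_generators_def)
      then show ?thesis
        unfolding H_def
        using word_value_eq_play[of "[(j, True)]"] by (auto simp: image_iff intro!: bexI)
    qed
    have "transport (generator (0, True)) \<otimes>\<^bsub>F_group\<^esub> transport (generator (2, True))
        \<noteq> transport (generator (2, True)) \<otimes>\<^bsub>F_group\<^esub> transport (generator (0, True))"
    proof
      assume commute: "transport (generator (0, True)) \<otimes>\<^bsub>F_group\<^esub> transport (generator (2, True))
        = transport (generator (2, True)) \<otimes>\<^bsub>F_group\<^esub> transport (generator (0, True))"
      \<comment> \<open>The two products send the point \<open>13 = 5 * 2 + 3\<close> to different arenas.\<close>
      let ?u = "[(0, True), (2, True)]" and ?v = "[(2, True), (0, True)] :: (nat \<times> bool) list"
      have "transport (play ?u) = transport (play ?v)"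
        using commute by (simp add: mult transport_mult uniformly_dyadic_generator)
      then have "play ?u (5 * real 2 + 3) = play ?v (5 * real 2 + 3)"
        by (rule transport_eqD[OF dyadic dyadic]) simp
      moreover have "\<lfloor>play ?u (5 * real 2 + 3)\<rfloor> mod 5 = arena (0, True)"
        using play_ping_pong[of ?u 2] by (simp add: cancels_def del: play_simps)
      moreover have "\<lfloor>play ?v (5 * real 2 + 3)\<rfloor> mod 5 = arena (2, True)"
        using play_ping_pong[of ?v 2] by (simp add: cancels_def del: play_simps)
      ultimately show False by (simp add: arena_def)
    qed
    then show ?thesis using in_H[of 0] in_H[of 2] by blast
  qed
  ultimately show ?thesis by blast
qed

end
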